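(* Let $k\ge 2$ and $n\ge k$ be integers, and write $n=ks+r$ with integers $s\ge 1$ and $0\le r<k$. Let $\mathcal{H}$ be a connected $k$-uniform hypergraph on $n$ vertices. If $k\nmid n$ (i.e. $r\neq 0$), then $W(\mathcal{H})\le W(P_n^k)$, with equality if and only if $\mathcal{H}$ is isomorphic to $P_n^k$. If $k\mid n$ (i.e. $r=0$), then $W(\mathcal{H})\le W(P_{n,1}^k)$, with equality if and only if $\mathcal{H}$ is isomorphic to $P_{n,x}^k$ for some integer $0<x<k$.
   Context: A $k$-uniform hypergraph is a pair $(V,E)$ with $V$ a finite vertex set and $E\subseteq\binom{V}{k}$ a set of $k$-element subsets (edges). A Berge path is a sequence of distinct vertices and distinct edges $v_0h_1v_1h_2\dots h_dv_d$ with $v_{i-1},v_i\in h_i$ for all $1\le i\le d$; its length is $d$. The hypergraph is connected if every pair of vertices is joined by a Berge path, and $d_{\mathcal{H}}(u,v)$ is the minimum length of a Berge path from $u$ to $v$. The Wiener index is $W(\mathcal{H})=\sum_{\{u,v\}\subseteq V}d_{\mathcal{H}}(u,v)$. For $[a,b]=\{a,a+1,\dots,b\}$: when $r\ne0$, $P_n^k$ is the hypergraph on vertex set $[1,n]$ with edge set $\{[(i-1)k+1,ik]:1\le i\le s\}\cup\{[r+(i-1)k+1,ik+r]:1\le i\le s\}$. When $r=0$ and $0<x<k$, $P_{n,x}^k$ is the hypergraph on vertex set $[1,n]$ with edge set $\{[(i-1)k+1,ik]:1\le i\le s\}\cup\{[(i-1)k+1+x,ik+x]:1\le i\le s-1\}$.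 *)

theory Defs
  imports Main
begin

type_synonym 'a hypergraph = "'a set \<times> 'a set set"

abbreviation verts :: "'a hypergraph \<Rightarrow> 'a set" where
  "verts H \<equiv> fst H"

abbreviation edges :: "'a hypergraph \<Rightarrow> 'a set set" where
  "edges H \<equiv> snd H"

definition uniform_hypergraph :: "nat \<Rightarrow> 'a hypergraph \<Rightarrow> bool" where
  "uniform_hypergraph k H \<longleftrightarrow>
     finite (verts H) \<and> edges H \<subseteq> {e. e \<subseteq> verts H \<and> card e = k}"

text \<open>The vertex list \<open>[v\<^sub>0, \<dots>, v\<^sub>d]\<close> and the edge list \<open>[h\<^sub>1, \<dots>, h\<^sub>d]\<close> are both indexed
  from 0, so \<open>es ! i\<close> is the edge between \<open>vs ! i\<close> and \<open>vs ! Suc i\<close>.\<close>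

definition berge_path ::
  "'a hypergraph \<Rightarrow> 'a \<Rightarrow> 'a list \<Rightarrow> 'a set list \<Rightarrow> 'a \<Rightarrow> bool" where
  "berge_path H u vs es v \<longleftrightarrow>
     length vs = Suc (length es) \<and> hd vs = u \<and> last vs = v \<and>
     set vs \<subseteq> verts H \<and> set es \<subseteq> edges H \<and> distinct vs \<and> distinct es \<and>
     (\<forall>i<length es. vs ! i \<in> es ! i \<and> vs ! Suc i \<in> es ! i)"

definition connected_hypergraph :: "'a hypergraph \<Rightarrow> bool" where
  "connected_hypergraph H \<longleftrightarrow>
     (\<forall>u\<in>verts H. \<forall>v\<in>verts H. \<exists>vs es. berge_path H u vs es v)"

definition hdist :: "'a hypergraph \<Rightarrow> 'a \<Rightarrow> 'a \<Rightarrow> nat" where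
  "hdist H u v = (LEAST d. \<exists>vs es. berge_path H u vs es v \<and> length es = d)"

lemma berge_path_rev:
  assumes "berge_path H u vs es v"
  shows "berge_path H v (rev vs) (rev es) u"
proof -
  have ne: "vs \<noteq> []" and len: "length vs = Suc (length es)"
    using assms by (auto simp: berge_path_def)
  have "rev vs ! i \<in> rev es ! i \<and> rev vs ! Suc i \<in> rev es ! i" if i: "i < length es" for i
  proof -
    let ?j = "length es - Suc i"
    have "vs ! ?j \<in> es ! ?j \<and> vs ! Suc ?j \<in> es ! ?j"
      using assms i by (auto simp: berge_path_def)
    moreover have "rev es ! i = es ! ?j" "rev vs ! i = vs ! Suc ?j" "rev vs ! Suc i = vs ! ?j"
      using i len by (simp_all add: rev_nth Suc_diff_Suc)
    ultimately show ?thesis by simp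
  qed
  then show ?thesis
    using assms ne by (auto simp: berge_path_def hd_rev last_rev)
qed

lemma hdist_commute: "hdist H u v = hdist H v u"
proof -
  have "(\<exists>vs es. berge_path H u vs es v \<and> length es = d) \<longleftrightarrow>
        (\<exists>vs es. berge_path H v vs es u \<and> length es = d)" for d
    by (metis berge_path_rev length_rev)
  then show ?thesis by (simp add: hdist_def)
qed

text \<open>The distance of an unordered pair; \<open>pair_dist_doubleton\<close> below shows that the
  definite description is well defined.\<close>

definition pair_dist :: "'a hypergraph \<Rightarrow> 'a set \<Rightarrow> nat" where
  "pair_dist H p = (THE d. \<exists>u v. p = {u, v} \<and> d = hdist H u v)"

lemma pair_dist_doubleton: "pair_dist H {u, v} = hdist H u v"
  unfolding pair_dist_def
  by (rule the_equality) (auto simp: doubleton_eq_iff hdist_commute)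

definition wiener_index :: "'a hypergraph \<Rightarrow> nat" where
  "wiener_index H = (\<Sum>p\<in>{p. p \<subseteq> verts H \<and> card p = 2}. pair_dist H p)"

definition hypergraph_iso :: "'a hypergraph \<Rightarrow> 'b hypergraph \<Rightarrow> bool" where
  "hypergraph_iso G H \<longleftrightarrow>
     (\<exists>f. bij_betw f (verts G) (verts H) \<and> (\<lambda>e. f ` e) ` edges G = edges H)"

text \<open>\<open>path_nondiv k n\<close> is \<open>P\<^sub>n\<^sup>k\<close>, meant for \<open>k\<close> not dividing \<open>n\<close>, and \<open>path_div k n x\<close> is
  \<open>P\<^sub>n\<^sub>,\<^sub>x\<^sup>k\<close>, meant for \<open>k\<close> dividing \<open>n\<close> and \<open>0 < x < k\<close>. With \<open>n = k * s + r\<close> and \<open>r < k\<close> one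
  has \<open>s = n div k\<close> and \<open>r = n mod k\<close>. In both, \<open>i \<ge> 1\<close> keeps \<open>i - 1\<close> from truncating.\<close>

definition path_nondiv :: "nat \<Rightarrow> nat \<Rightarrow> nat hypergraph" where
  "path_nondiv k n =
     (let s = n div k; r = n mod k in
      ({1..n},
       {{(i - 1) * k + 1..i * k} | i. 1 \<le> i \<and> i \<le> s} \<union>
       {{r + (i - 1) * k + 1..i * k + r} | i. 1 \<le> i \<and> i \<le> s}))"

definition path_div :: "nat \<Rightarrow> nat \<Rightarrow> nat \<Rightarrow> nat hypergraph" where
  "path_div k n x =
     (let s = n div k in
      ({1..n},
       {{(i - 1) * k + 1..i * k} | i. 1 \<le> i \<and> i \<le> s} \<union>
       {{(i - 1) * k + 1 + x..i * k + x} | i. 1 \<le> i \<and> i \<le> s - 1}))"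

end

theory Submission
  imports Defs Complex_Main
begin

text \<open>Deleting edges that are not needed for connectivity only increases distances, so assume that
  no edge can be removed. Then some edge \<open>e\<close> is a leaf: the set \<open>S\<close> of its \<open>t\<close> pendant vertices, those
  lying in no other edge, is non-empty, and deleting \<open>S\<close> leaves a connected \<open>k\<close>-uniform hypergraph.
  Consider the distance levels from \<open>u \<in> S\<close>. Level 1 has \<open>k - 1\<close> vertices, any two consecutive
  non-empty levels contain an edge and so at least \<open>k\<close> vertices, and level 2 has at least \<open>t\<close>
  vertices because an edge reaching it from level 1 avoids \<open>S\<close>. This bounds the distance sum of
  \<open>u\<close>, and induction on the number of edges gives \<open>2 W \<le> max_dist_sum\<close>, the slack of the step being
  \<open>2 t (r - t)\<close> if \<open>t \<le> r\<close> and \<open>2 r\<^sup>2\<close> if \<open>r < t\<close>. Equality forces the levels seen from \<open>S\<close> to have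
  sizes \<open>t, k - t, t, k - t, \<dots>\<close>; every edge is then the union of two consecutive levels, which
  determines the hypergraph up to isomorphism.\<close>

section \<open>Walk distance\<close>

text \<open>Reflexive at every covered vertex, so adjacency alone does not give distinct
  vertices.\<close>

definition adj :: "'a set set \<Rightarrow> ('a \<times> 'a) set" where
  "adj E = {(u, v). \<exists>e\<in>E. u \<in> e \<and> v \<in> e}"

text \<open>Walks carry no distinctness conditions and therefore concatenate freely;
  \<open>shortest_walk_berge_path\<close> shows that the least length is the same. For unreachable
  pairs the \<open>LEAST\<close> says nothing, hence the reachability premises below.\<close>

definition gdist :: "'a set set \<Rightarrow> 'a \<Rightarrow> 'a \<Rightarrow> nat" where
  "gdist E u v = (LEAST d. (u, v) \<in> adj E ^^ d)"

definition uconn :: "nat \<Rightarrow> 'a set \<Rightarrow> 'a set set \<Rightarrow> bool" where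
  "uconn k V E \<longleftrightarrow> finite V \<and> (\<forall>e\<in>E. e \<subseteq> V \<and> card e = k) \<and> V \<times> V \<subseteq> (adj E)\<^sup>*"

text \<open>Ordered pairs count each distance twice, so this is twice the Wiener index; the sum
  splits easily along a partition of the vertices.\<close>

definition dist_sum :: "'a set \<Rightarrow> 'a set set \<Rightarrow> nat" where
  "dist_sum V E = (\<Sum>u\<in>V. \<Sum>v\<in>V. gdist E u v)"

lemma adjI: "e \<in> E \<Longrightarrow> u \<in> e \<Longrightarrow> v \<in> e \<Longrightarrow> (u, v) \<in> adj E"
  by (auto simp: adj_def)

lemma sym_adj: "sym (adj E)"
  by (auto simp: adj_def sym_def)

lemma adj_mono: "E \<subseteq> F \<Longrightarrow> adj E \<subseteq> adj F"
  by (auto simp: adj_def)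

lemma rtrancl_adj_sym: "(u, v) \<in> (adj E)\<^sup>* \<Longrightarrow> (v, u) \<in> (adj E)\<^sup>*"
  by (metis sym_adj sym_rtrancl symD)

lemma uconn_rtrancl: "uconn k V E \<Longrightarrow> u \<in> V \<Longrightarrow> v \<in> V \<Longrightarrow> (u, v) \<in> (adj E)\<^sup>*"
  by (auto simp: uconn_def)

lemma uconn_finite: "uconn k V E \<Longrightarrow> finite V"
  by (auto simp: uconn_def)

lemma uconn_finite_edges: "uconn k V E \<Longrightarrow> finite E"
  by (auto simp: uconn_def intro: finite_subset[of E "Pow V"])

lemma uconn_edge: "uconn k V E \<Longrightarrow> e \<in> E \<Longrightarrow> e \<subseteq> V \<and> card e = k"
  by (auto simp: uconn_def)

lemma uconn_edge_finite: "uconn k V E \<Longrightarrow> e \<in> E \<Longrightarrow> finite e"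
  by (auto simp: uconn_def intro: finite_subset)

lemma gdist_le: "(u, v) \<in> adj E ^^ d \<Longrightarrow> gdist E u v \<le> d"
  unfolding gdist_def by (rule Least_le)

lemma gdist_walk: "(u, v) \<in> (adj E)\<^sup>* \<Longrightarrow> (u, v) \<in> adj E ^^ gdist E u v"
  unfolding gdist_def rtrancl_power by (rule LeastI_ex)

lemma gdist_refl [simp]: "gdist E u u = 0"
  using gdist_le[of u u 0 E] by simp

lemma gdist_eq_0: "(u, v) \<in> (adj E)\<^sup>* \<Longrightarrow> gdist E u v = 0 \<Longrightarrow> u = v"
  using gdist_walk[of u v E] by simp

lemma gdist_sym: "gdist E u v = gdist E v u"
proof -
  have "(u, v) \<in> adj E ^^ d \<Longrightarrow> (v, u) \<in> adj E ^^ d" for u v d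
  proof (induction d arbitrary: v)
    case (Suc d)
    then obtain w where "(u, w) \<in> adj E ^^ d" "(w, v) \<in> adj E" by auto
    with Suc show ?case by (meson relpow_Suc_I2 sym_adj symD)
  qed simp
  then show ?thesis unfolding gdist_def by metis
qed

lemma gdist_adj_le: "(u, v) \<in> adj E \<Longrightarrow> gdist E u v \<le> 1"
  by (rule gdist_le) simp

lemma gdist_step:
  assumes "(u, v) \<in> (adj E)\<^sup>*" "(v, w) \<in> adj E"
  shows "gdist E u w \<le> Suc (gdist E u v)"
  using gdist_walk[OF assms(1)] assms(2) by (intro gdist_le) auto

lemma gdist_pred:
  assumes "(u, w) \<in> (adj E)\<^sup>*" "gdist E u w = Suc d"
  obtains v where "(u, v) \<in> (adj E)\<^sup>*" "(v, w) \<in> adj E" "gdist E u v = d"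
proof -
  have "(u, w) \<in> adj E ^^ Suc d" using gdist_walk[OF assms(1)] assms(2) by simp
  then obtain v where v: "(u, v) \<in> adj E ^^ d" "(v, w) \<in> adj E" by auto
  then have uv: "(u, v) \<in> (adj E)\<^sup>*" by (meson relpow_imp_rtrancl)
  moreover have "gdist E u v = d"
    using gdist_step[OF uv v(2)] gdist_le[OF v(1)] assms(2) by simp
  ultimately show ?thesis using that v by blast
qed

lemma gdist_antimono:
  assumes "E \<subseteq> F" "(u, v) \<in> (adj E)\<^sup>*"
  shows "gdist F u v \<le> gdist E u v"
proof (rule gdist_le)
  have "adj E ^^ d \<subseteq> adj F ^^ d" for d
    by (induction d) (use adj_mono[OF assms(1)] in auto)
  then show "(u, v) \<in> adj F ^^ gdist E u v" using gdist_walk[OF assms(2)] by blast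
qed

lemma gdist_eq_1_iff:
  assumes "uconn k V E" "u \<in> V" "v \<in> V"
  shows "gdist E u v = 1 \<longleftrightarrow> u \<noteq> v \<and> (u, v) \<in> adj E"
proof
  assume "gdist E u v = 1"
  then show "u \<noteq> v \<and> (u, v) \<in> adj E"
    using gdist_walk[OF uconn_rtrancl[OF assms]] by auto
next
  assume "u \<noteq> v \<and> (u, v) \<in> adj E"
  then show "gdist E u v = 1"
    using gdist_adj_le[of u v E] gdist_eq_0[OF uconn_rtrancl[OF assms]] by linarith
qed

section \<open>Berge paths and the Wiener index\<close>

lemma berge_path_walk:
  assumes "berge_path H u vs es v"
  shows "(u, v) \<in> adj (edges H) ^^ length es"
proof -
  have "vs \<noteq> []" using assms by (auto simp: berge_path_def)
  then have "vs ! 0 = u" "vs ! length es = v"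
    using assms by (auto simp: berge_path_def hd_conv_nth last_conv_nth)
  moreover have "(vs ! i, vs ! Suc i) \<in> adj (edges H)" if "i < length es" for i
    using assms that by (auto simp: berge_path_def intro!: adjI[of "es ! i"])
  ultimately show ?thesis unfolding relpow_fun_conv by blast
qed

text \<open>A repeated vertex or a repeated edge would allow a shortcut, so a shortest walk is
  already a Berge path.\<close>

lemma shortest_walk_berge_path:
  assumes walk: "(u, v) \<in> (adj (edges H))\<^sup>*" and u: "u \<in> verts H"
    and E: "\<forall>e\<in>edges H. e \<subseteq> verts H"
  shows "\<exists>vs es. berge_path H u vs es v \<and> length es = gdist (edges H) u v"
proof -
  define E where "E = edges H"
  define d where "d = gdist E u v"
  obtain f where f: "f 0 = u" "f d = v" and step: "\<And>i. i < d \<Longrightarrow> (f i, f (Suc i)) \<in> adj E"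
    using gdist_walk[OF walk] unfolding relpow_fun_conv d_def E_def by blast
  have sub: "(f i, f j) \<in> adj E ^^ (j - i)" if "i \<le> j" "j \<le> d" for i j
    unfolding relpow_fun_conv using that
    by (intro exI[of _ "\<lambda>l. f (i + l)"]) (auto intro: step)
  \<comment> \<open>Splicing another walk between two vertices of a shortest walk cannot make it
    shorter. With \<open>l = 0\<close> this gives distinct vertices, with \<open>l = 1\<close>
    distinct edges.\<close>
  have short: "j - i \<le> l" if "i \<le> j" "j \<le> d" "(f i, f j) \<in> adj E ^^ l" for i j l
  proof -
    have "(u, f i) \<in> adj E ^^ i" "(f j, v) \<in> adj E ^^ (d - j)"
      using sub[of 0 i] sub[of j d] that f by auto
    with that(3) have "(u, v) \<in> adj E ^^ (i + (l + (d - j)))"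
      unfolding relpow_add by blast
    then have "d \<le> i + (l + (d - j))" unfolding d_def by (rule gdist_le)
    then show ?thesis using that by linarith
  qed
  have "\<forall>i. \<exists>e. i < d \<longrightarrow> e \<in> E \<and> f i \<in> e \<and> f (Suc i) \<in> e"
    using step unfolding adj_def by blast
  then obtain g where g: "\<And>i. i < d \<Longrightarrow> g i \<in> E \<and> f i \<in> g i \<and> f (Suc i) \<in> g i" by metis
  have "i = j" if "i \<le> j" "j \<le> d" "f i = f j" for i j
    using short[of i j 0] that by auto
  then have inj_f: "inj_on f {..d}"
    by (intro inj_onI) (metis atMost_iff nat_le_linear)
  \<comment> \<open>If steps \<open>i\<close> and \<open>j\<close> use the same edge, then
    \<open>f i\<close> and \<open>f (Suc j)\<close> both lie in it, so
    \<open>Suc j - i \<le> 1\<close>.\<close>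
  have "i = j" if "i \<le> j" "j < d" "g i = g j" for i j
  proof -
    have "(f i, f (Suc j)) \<in> adj E" using g[of i] g[of j] that by (intro adjI[of "g i"]) auto
    then show ?thesis using short[of i "Suc j" 1] that by auto
  qed
  then have inj_g: "inj_on g {..<d}"
    by (intro inj_onI) (metis lessThan_iff nat_le_linear)
  have "f i \<in> verts H" if "i \<le> d" for i
  proof (cases i)
    case 0 then show ?thesis using f u by simp
  next
    case (Suc j) then show ?thesis using g[of j] that E unfolding E_def by auto
  qed
  moreover have "distinct (map f [0..<Suc d])" "distinct (map g [0..<d])"
    using inj_f inj_g by (auto simp: distinct_map atLeast0LessThan lessThan_Suc_atMost
      simp del: upt_Suc)
  ultimately have "berge_path H u (map f [0..<Suc d]) (map g [0..<d]) v"
    unfolding berge_path_def using f g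
    by (auto simp: hd_map last_map E_def simp del: upt_Suc)
  then show ?thesis unfolding d_def E_def by (intro exI conjI) (assumption, simp)
qed

lemma connected_iff_uconn:
  "uniform_hypergraph k H \<and> connected_hypergraph H \<longleftrightarrow> uconn k (verts H) (edges H)"
proof -
  have "(\<exists>vs es. berge_path H u vs es v) \<longleftrightarrow> (u, v) \<in> (adj (edges H))\<^sup>*"
    if "\<forall>e\<in>edges H. e \<subseteq> verts H" "u \<in> verts H" for u v
    using that berge_path_walk[of H u _ _ v] shortest_walk_berge_path[of u v H]
    by (meson relpow_imp_rtrancl)
  then have "(\<forall>u\<in>verts H. \<forall>v\<in>verts H. \<exists>vs es. berge_path H u vs es v) \<longleftrightarrow>
      verts H \<times> verts H \<subseteq> (adj (edges H))\<^sup>*" if "\<forall>e\<in>edges H. e \<subseteq> verts H"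
    using that by (simp add: subset_iff) blast
  then show ?thesis
    unfolding uconn_def uniform_hypergraph_def connected_hypergraph_def
    by (cases "\<forall>e\<in>edges H. e \<subseteq> verts H"; simp only: subset_iff[of "edges H"] mem_Collect_eq) blast+
qed

lemma hdist_eq_gdist:
  assumes "uconn k (verts H) (edges H)" "u \<in> verts H" "v \<in> verts H"
  shows "hdist H u v = gdist (edges H) u v"
  unfolding hdist_def
proof (rule Least_equality)
  show "\<exists>vs es. berge_path H u vs es v \<and> length es = gdist (edges H) u v"
    using assms by (intro shortest_walk_berge_path) (auto simp: uconn_def)
qed (blast dest: berge_path_walk intro: gdist_le)

text \<open>\<open>p\<close> and \<open>d\<close> stay abstract so that \<open>V\<close> can shrink
  in the induction while the distances remain those of the whole hypergraph.\<close>

lemma sum_pairs_eq_2_times: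
  fixes d :: "'a \<Rightarrow> 'a \<Rightarrow> nat"
  assumes "finite V" "\<And>u v. d u v = d v u" "\<And>u. d u u = 0"
    and "\<And>u v. u \<in> V \<Longrightarrow> v \<in> V \<Longrightarrow> p {u, v} = d u v"
  shows "2 * (\<Sum>e\<in>{e. e \<subseteq> V \<and> card e = 2}. p e) = (\<Sum>u\<in>V. \<Sum>v\<in>V. d u v)"
  using assms(1,4)
proof (induction V)
  case empty
  have "{e::'a set. e \<subseteq> {} \<and> card e = 2} = {}" by auto
  then show ?case by simp
next
  case (insert x V)
  have eq: "{e. e \<subseteq> insert x V \<and> card e = 2} =
      {e. e \<subseteq> V \<and> card e = 2} \<union> (\<lambda>v. {x, v}) ` V" (is "?L = ?A \<union> ?B")
  proof
    show "?L \<subseteq> ?A \<union> ?B"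
    proof
      fix e assume e: "e \<in> ?L"
      then obtain a b where ab: "e = {a, b}" "a \<noteq> b" by (auto simp: card_2_iff)
      with e show "e \<in> ?A \<union> ?B" by (cases "a = x"; cases "b = x") auto
    qed
  qed (use insert in \<open>auto simp: card_2_iff\<close>)
  have "(\<Sum>e\<in>?L. p e) = (\<Sum>e\<in>?A. p e) + (\<Sum>e\<in>?B. p e)"
    unfolding eq using insert(1,2) by (intro sum.union_disjoint) auto
  also have "(\<Sum>e\<in>?B. p e) = (\<Sum>v\<in>V. p {x, v})"
    using insert(2) by (subst sum.reindex) (auto simp: inj_on_def doubleton_eq_iff)
  also have "\<dots> = (\<Sum>v\<in>V. d x v)" using insert by (intro sum.cong) auto
  finally have "2 * (\<Sum>e\<in>?L. p e) = (\<Sum>u\<in>V. \<Sum>v\<in>V. d u v) + 2 * (\<Sum>v\<in>V. d x v)"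
    using insert by simp
  moreover have "(\<Sum>v\<in>V. d v x) = (\<Sum>v\<in>V. d x v)" using assms(2) by simp
  ultimately show ?case using insert(1,2) assms(3) by (simp add: sum.distrib)
qed

lemma wiener_index_eq_dist_sum:
  assumes "uconn k (verts H) (edges H)"
  shows "2 * wiener_index H = dist_sum (verts H) (edges H)"
  unfolding wiener_index_def dist_sum_def
  by (rule sum_pairs_eq_2_times)
    (use assms in \<open>auto simp: pair_dist_doubleton hdist_eq_gdist uconn_finite gdist_sym\<close>)

section \<open>A leaf edge\<close>

lemma rtrancl_leaves_set:
  assumes "(a, b) \<in> R\<^sup>*" "a \<in> K" "b \<notin> K"
  obtains x y where "(x, y) \<in> R" "x \<in> K" "y \<notin> K"
proof -
  have "b \<notin> K \<longrightarrow> (\<exists>x y. (x, y) \<in> R \<and> x \<in> K \<and> y \<notin> K)"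
    using assms(1,2) by (induction rule: rtrancl_induct) blast+
  then show ?thesis using that assms by blast
qed

text \<open>Choose \<open>e\<close> and \<open>v\<close> such that the component \<open>K\<close> of
  \<open>v\<close> after deleting \<open>e\<close> is as large as possible. If another edge
  \<open>f\<close> were not inside \<open>K\<close>, it would miss \<open>K\<close>; deleting
  \<open>f\<close> instead of \<open>e\<close> would keep \<open>K\<close> connected, and
  \<open>e\<close> would add a vertex to it. So all edges except \<open>e\<close> lie in
  \<open>K\<close>.\<close>

lemma leaf_edge_exists:
  assumes H: "uconn k V E" and ne: "E \<noteq> {}" "V \<noteq> {}"
    and min: "\<And>e. e \<in> E \<Longrightarrow> \<not> uconn k V (E - {e})"
  obtains e K where "e \<in> E" "K \<subset> V" "e \<inter> K \<noteq> {}" "V - K \<subseteq> e"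
    "\<And>f. f \<in> E \<Longrightarrow> f \<noteq> e \<Longrightarrow> f \<subseteq> K" "uconn k K (E - {e})"
proof -
  define cmp where "cmp = (\<lambda>(e, v). {w \<in> V. (v, w) \<in> (adj (E - {e}))\<^sup>*})"
  have finV: "finite V" by (rule uconn_finite[OF H])
  have "card (cmp q) < Suc (card V)" for q
    unfolding cmp_def by (cases q) (auto intro!: le_imp_less_Suc card_mono finV)
  moreover obtain q0 where "q0 \<in> E \<times> V" using ne by auto
  ultimately have "\<exists>p. p \<in> E \<times> V \<and> (\<forall>q. q \<in> E \<times> V \<longrightarrow> card (cmp q) \<le> card (cmp p))"
    by (intro ex_has_greatest_nat[of _ q0 _ "Suc (card V)"]) auto
  then obtain p where p: "p \<in> E \<times> V" "\<And>q. q \<in> E \<times> V \<Longrightarrow> card (cmp q) \<le> card (cmp p)"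
    by blast
  obtain e v where ev: "p = (e, v)" "e \<in> E" "v \<in> V" using p by auto
  define K where "K = cmp p"
  have K: "K = {w \<in> V. (v, w) \<in> (adj (E - {e}))\<^sup>*}" by (simp add: K_def ev cmp_def)
  have vK: "v \<in> K" using ev by (simp add: K)
  have KK: "K \<times> K \<subseteq> (adj (E - {e}))\<^sup>*"
  proof clarify
    fix a b assume "a \<in> K" "b \<in> K"
    then have "(a, v) \<in> (adj (E - {e}))\<^sup>*" "(v, b) \<in> (adj (E - {e}))\<^sup>*"
      using rtrancl_adj_sym[of v a] by (auto simp: K)
    then show "(a, b) \<in> (adj (E - {e}))\<^sup>*" by (rule rtrancl_trans)
  qed
  have KV: "K \<noteq> V" using min[OF ev(2)] H KK by (auto simp: uconn_def)
  have closed: "f \<subseteq> K" if f: "f \<in> E" "f \<noteq> e" "f \<inter> K \<noteq> {}" for f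
  proof
    fix y assume y: "y \<in> f"
    obtain z where z: "z \<in> f" "z \<in> K" using f(3) by blast
    then have "(z, y) \<in> adj (E - {e})" using f y by (intro adjI[of f]) auto
    then show "y \<in> K" using z uconn_edge[OF H f(1)] y unfolding K
      by (auto intro: rtrancl_into_rtrancl)
  qed
  obtain w where w: "w \<in> V" "w \<notin> K" using KV K by blast
  \<comment> \<open>\<open>K\<close> is a component of the hypergraph without \<open>e\<close>, so
    the edge by which a walk leaves \<open>K\<close> must be \<open>e\<close>.\<close>
  obtain x y where xy: "(x, y) \<in> adj E" "x \<in> K" "y \<notin> K"
    using rtrancl_leaves_set[OF uconn_rtrancl[OF H ev(3) w(1)] vK w(2)] .
  then obtain g where g: "g \<in> E" "x \<in> g" "y \<in> g" by (auto simp: adj_def)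
  have [simp]: "g = e" using closed[of g] g xy by blast
  have inK: "f \<subseteq> K" if f: "f \<in> E" "f \<noteq> e" for f
  proof (rule ccontr)
    assume "\<not> f \<subseteq> K"
    then have disj: "f \<inter> K = {}" using closed f by blast
    \<comment> \<open>Walks from \<open>v\<close> avoiding \<open>e\<close> stay inside
      \<open>K\<close>, hence never use \<open>f\<close> and survive its deletion.\<close>
    have "(v, z) \<in> (adj (E - {f}))\<^sup>* \<and> z \<in> K" if "(v, z) \<in> (adj (E - {e}))\<^sup>*" for z
      using that
    proof (induction rule: rtrancl_induct)
      case base then show ?case using vK by simp
    next
      case (step a b)
      then obtain h where h: "h \<in> E" "h \<noteq> e" "a \<in> h" "b \<in> h" by (auto simp: adj_def)
      with step disj have "h \<noteq> f" "b \<in> K" using closed[of h] by blast+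
      then show ?case using step h by (auto intro: rtrancl_into_rtrancl adjI[of h])
    qed
    then have sub: "K \<subseteq> cmp (f, v)" unfolding cmp_def K by auto
    moreover have "y \<in> cmp (f, v)"
    proof -
      have "(v, x) \<in> (adj (E - {f}))\<^sup>*" using sub xy by (auto simp: cmp_def)
      moreover have "(x, y) \<in> adj (E - {f})" using g f by (intro adjI[of e]) auto
      ultimately show ?thesis using uconn_edge[OF H g(1)] g
        by (auto simp: cmp_def intro: rtrancl_into_rtrancl)
    qed
    ultimately have "K \<subset> cmp (f, v)" using xy by blast
    moreover have "finite (cmp (f, v))" using finV by (simp add: cmp_def)
    ultimately have "card K < card (cmp (f, v))" by (rule psubset_card_mono[rotated])
    then show False using p(2)[of "(f, v)"] f ev by (auto simp: K_def)
  qed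
  have out: "V - K \<subseteq> e"
  proof
    fix z assume z: "z \<in> V - K"
    \<comment> \<open>\<open>v \<noteq> z\<close> guarantees a last step of the walk, hence an edge
      through \<open>z\<close>. It is not contained in \<open>K\<close>, so it is
      \<open>e\<close>.\<close>
    then have "(v, z) \<in> (adj E)\<^sup>*" "v \<noteq> z" using H ev vK by (auto simp: uconn_def)
    then obtain z' where "(z', z) \<in> adj E" by (auto elim: rtranclE)
    then show "z \<in> e" using inK z by (auto simp: adj_def)
  qed
  show ?thesis
  proof (rule that[of e K])
    show "uconn k K (E - {e})"
      using H inK KK finV K unfolding uconn_def by (auto intro: finite_subset)
    show "K \<subset> V" using KV K by blast
    show "e \<inter> K \<noteq> {}" using xy g by auto
  qed (use ev inK out in auto)
qed

section \<open>Distance from a pendant vertex\<close>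

text \<open>Counting vertices beyond each threshold turns a distance sum into a sum over levels, see
  \<open>sum_gdist_eq_sum_far\<close>.\<close>

definition far :: "'a set \<Rightarrow> 'a set set \<Rightarrow> 'a \<Rightarrow> nat \<Rightarrow> nat" where
  "far V E u i = card {v \<in> V. i \<le> gdist E u v}"

lemma gdist_attains_smaller:
  assumes H: "uconn k V E" and u: "u \<in> V" and w: "w \<in> V" and i: "i \<le> gdist E u w"
  shows "\<exists>x\<in>V. gdist E u x = i"
  using w i
proof (induction "gdist E u w - i" arbitrary: w)
  case 0 then show ?case by auto
next
  case (Suc d)
  then obtain j where j: "gdist E u w = Suc j" "i \<le> j" "j - i = d"
    by (cases "gdist E u w") auto
  obtain x where x: "(x, w) \<in> adj E" "gdist E u x = j"
    using gdist_pred[OF uconn_rtrancl[OF H u Suc(3)] j(1)] .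
  then have "x \<in> V" using H by (auto simp: adj_def uconn_def)
  with Suc.hyps(1)[of x] x j show ?case by auto
qed

text \<open>Take the last edge of a shortest walk to \<open>w\<close>: each of its vertices is at
  most one step from \<open>w\<close> and from the preceding vertex, which has distance
  \<open>i\<close>.\<close>

lemma edge_between_levels:
  assumes H: "uconn k V E" and u: "u \<in> V" and w: "w \<in> V" and d: "gdist E u w = Suc i"
  obtains f where "f \<in> E" "w \<in> f" "\<And>x. x \<in> f \<Longrightarrow> gdist E u x = i \<or> gdist E u x = Suc i"
proof -
  obtain x where x: "(u, x) \<in> (adj E)\<^sup>*" "(x, w) \<in> adj E" "gdist E u x = i"
    using gdist_pred[OF uconn_rtrancl[OF H u w] d] .
  then obtain f where f: "f \<in> E" "x \<in> f" "w \<in> f" by (auto simp: adj_def)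
  show ?thesis
  proof (rule that[of f])
    fix y assume y: "y \<in> f"
    then have "y \<in> V" using uconn_edge[OF H f(1)] by blast
    then have "gdist E u w \<le> Suc (gdist E u y)"
      using gdist_step[OF uconn_rtrancl[OF H u]] y f adjI by metis
    moreover have "gdist E u y \<le> Suc i"
      using gdist_step[OF x(1)] x(3) y f adjI by metis
    ultimately show "gdist E u y = i \<or> gdist E u y = Suc i" using d by linarith
  qed (use f in auto)
qed

lemma far_Suc_pos:
  assumes H: "uconn k V E" and u: "u \<in> V" and pos: "far V E u (Suc i) > 0"
  shows "\<exists>f\<in>E. (\<forall>x\<in>f. gdist E u x = i \<or> gdist E u x = Suc i) \<and> (\<exists>w\<in>f. gdist E u w = Suc i)"
proof -
  have "{v \<in> V. Suc i \<le> gdist E u v} \<noteq> {}"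
    using pos unfolding far_def card_gt_0_iff by simp
  then obtain w where "w \<in> V" "Suc i \<le> gdist E u w" by auto
  then obtain w' where w': "w' \<in> V" "gdist E u w' = Suc i"
    using gdist_attains_smaller[OF H u] by blast
  obtain f where "f \<in> E" "w' \<in> f" "\<And>x. x \<in> f \<Longrightarrow> gdist E u x = i \<or> gdist E u x = Suc i"
    using edge_between_levels[OF H u w'] by blast
  then show ?thesis using w' by blast
qed

text \<open>If level \<open>Suc i\<close> is non-empty, levels \<open>i\<close> and
  \<open>Suc i\<close> together contain a whole edge, and its \<open>k\<close> vertices drop out
  between the two counts.\<close>

lemma far_step:
  assumes H: "uconn k V E" and u: "u \<in> V" and pos: "far V E u (Suc i) > 0"
  shows "far V E u (Suc (Suc i)) + k \<le> far V E u i"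
proof -
  obtain f where f: "f \<in> E" "\<And>x. x \<in> f \<Longrightarrow> gdist E u x = i \<or> gdist E u x = Suc i"
    using far_Suc_pos[OF H u pos] by blast
  have fin: "finite V" by (rule uconn_finite[OF H])
  have "far V E u (Suc (Suc i)) + card f = card ({v \<in> V. Suc (Suc i) \<le> gdist E u v} \<union> f)"
    unfolding far_def using fin f uconn_edge_finite[OF H f(1)]
    by (intro card_Un_disjoint[symmetric]) (auto dest: f(2))
  also have "\<dots> \<le> far V E u i"
    unfolding far_def using fin uconn_edge[OF H f(1)] by (intro card_mono) (auto dest: f(2))
  finally show ?thesis using uconn_edge[OF H f(1)] by simp
qed

lemma far_antimono: "finite V \<Longrightarrow> i \<le> j \<Longrightarrow> far V E u j \<le> far V E u i"
  unfolding far_def by (intro card_mono) auto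

lemma sum_gdist_eq_sum_far:
  assumes "finite V" "far V E u (Suc m) = 0"
  shows "(\<Sum>v\<in>V. gdist E u v) = (\<Sum>i=1..m. far V E u i)"
proof -
  have "gdist E u v = (\<Sum>i=1..m. if i \<le> gdist E u v then 1 else 0)" if "v \<in> V" for v
  proof -
    have "{v \<in> V. Suc m \<le> gdist E u v} = {}" using assms by (simp add: far_def)
    then have "gdist E u v \<le> m" using that by (auto simp: not_less_eq_eq)
    then have "{1..m} \<inter> {i. i \<le> gdist E u v} = {1..gdist E u v}" by auto
    then show ?thesis by (simp add: sum.If_cases)
  qed
  then have "(\<Sum>v\<in>V. gdist E u v) = (\<Sum>v\<in>V. \<Sum>i=1..m. if i \<le> gdist E u v then 1 else 0)"
    by (rule sum.cong[OF refl])
  also have "\<dots> = (\<Sum>i=1..m. \<Sum>v\<in>V. if i \<le> gdist E u v then 1 else 0)"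
    by (rule sum.swap)
  also have "\<dots> = (\<Sum>i=1..m. far V E u i)"
    using assms(1) by (intro sum.cong refl) (simp add: far_def sum.If_cases Int_def)
  finally show ?thesis .
qed

text \<open>In the induction \<open>S\<close> is the set \<open>V - K\<close> from
  \<open>leaf_edge_exists\<close>, and \<open>u\<close> ranges over it.\<close>

locale pendant =
  fixes k :: nat and V :: "'a set" and E :: "'a set set" and e S :: "'a set" and u :: 'a
  assumes uconn: "uconn k V E" and e: "e \<in> E" and S: "S \<subseteq> e" and u: "u \<in> S"
    and pendant: "\<And>f. f \<in> E \<Longrightarrow> f \<noteq> e \<Longrightarrow> f \<inter> S = {}"
begin

lemma finite_V: "finite V" by (rule uconn_finite[OF uconn])
lemma eV: "e \<subseteq> V" and card_e: "card e = k" using uconn_edge[OF uconn e] by blast+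
lemma finite_e: "finite e" by (rule uconn_edge_finite[OF uconn e])
lemma finite_S: "finite S" by (rule finite_subset[OF S finite_e])
lemma ue: "u \<in> e" using S u by blast
lemma uV: "u \<in> V" using ue eV by blast

lemma adj_u_iff: "(u, v) \<in> adj E \<longleftrightarrow> v \<in> e"
proof
  assume "(u, v) \<in> adj E"
  then obtain f where "f \<in> E" "u \<in> f" "v \<in> f" by (auto simp: adj_def)
  with pendant[of f] u show "v \<in> e" by blast
qed (rule adjI[OF e ue])

lemma gdist_u_0: "v \<in> V \<Longrightarrow> gdist E u v = 0 \<longleftrightarrow> v = u"
  using gdist_eq_0[OF uconn_rtrancl[OF uconn uV, of v]] by auto

lemma gdist_u_1: "v \<in> V \<Longrightarrow> gdist E u v = 1 \<longleftrightarrow> v \<in> e - {u}"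
  unfolding gdist_eq_1_iff[OF uconn uV] adj_u_iff by blast

lemma gdist_u_ge_2:
  assumes "v \<in> V" shows "2 \<le> gdist E u v \<longleftrightarrow> v \<notin> e"
proof -
  have "2 \<le> gdist E u v \<longleftrightarrow> \<not> (gdist E u v = 0 \<or> gdist E u v = 1)" by linarith
  then show ?thesis unfolding gdist_u_0[OF assms] gdist_u_1[OF assms] using ue by blast
qed

lemma far_1: "far V E u 1 = card V - 1"
proof -
  have "{v \<in> V. 1 \<le> gdist E u v} = V - {u}"
    using gdist_u_0 by (auto simp: Suc_le_eq)
  then show ?thesis using uV by (simp add: far_def)
qed

lemma far_2: "far V E u 2 = card V - k"
proof -
  have "{v \<in> V. 2 \<le> gdist E u v} = V - e" using gdist_u_ge_2 by blast
  then show ?thesis using eV card_e finite_e by (simp add: far_def card_Diff_subset)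
qed

text \<open>An edge inside levels 1 and 2 that reaches level 2 is not \<open>e\<close>, so it is
  disjoint from \<open>S\<close>. Its \<open>k\<close> vertices and those of \<open>S\<close> all
  have distance at most 2. This improves on \<open>far_step\<close> by \<open>card S\<close> and
  starts the chain of odd thresholds.\<close>

lemma far_3:
  assumes "far V E u 2 > 0"
  shows "far V E u 3 + k + card S \<le> card V"
proof -
  obtain f where f: "f \<in> E" "\<And>x. x \<in> f \<Longrightarrow> gdist E u x = 1 \<or> gdist E u x = 2"
      "\<exists>w\<in>f. gdist E u w = 2"
    using far_Suc_pos[OF uconn uV, of 1, unfolded Suc_1, OF assms] by blast
  have fV: "f \<subseteq> V" "card f = k" "finite f"
    using uconn_edge[OF uconn f(1)] uconn_edge_finite[OF uconn f(1)] by auto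
  have "f \<noteq> e" using f(3) fV gdist_u_ge_2 by force
  then have "f \<inter> S = {}" using pendant f by blast
  then have "card f + card S = card (f \<union> S)"
    using fV finite_S by (intro card_Un_disjoint[symmetric]) auto
  moreover have "\<dots> + far V E u 3 = card ((f \<union> S) \<union> {v \<in> V. 3 \<le> gdist E u v})"
    unfolding far_def
  proof (intro card_Un_disjoint[symmetric])
    show "(f \<union> S) \<inter> {v \<in> V. 3 \<le> gdist E u v} = {}"
      using S eV gdist_u_ge_2 by (fastforce dest: f(2))
  qed (use finite_V fV finite_S in auto)
  moreover have "\<dots> \<le> card V"
    using finite_V fV S eV by (intro card_mono) auto
  ultimately show ?thesis using fV by simp
qed

text \<open>Each pair of levels uses up \<open>k\<close> vertices by \<open>far_step\<close>. Once
  the levels have ended the left side is 0, so truncation on the right does no harm.\<close>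

lemma far_even: "far V E u (2 * Suc j) \<le> card V - Suc j * k"
proof (induction j)
  case 0 then show ?case using far_2 by simp
next
  case (Suc j)
  show ?case
  proof (cases "far V E u (2 * Suc j + 1) = 0")
    case True
    then have "far V E u (2 * Suc (Suc j)) = 0"
      using far_antimono[OF finite_V, of "2 * Suc j + 1" "2 * Suc (Suc j)" E u] by simp
    then show ?thesis by simp
  next
    case False
    then show ?thesis using far_step[OF uconn uV, of "2 * Suc j"] Suc by simp
  qed
qed

lemma far_odd: "far V E u (2 * j + 3) \<le> card V - Suc j * k - card S"
proof (induction j)
  case 0
  show ?case
  proof (cases "far V E u 2 = 0")
    case True
    then show ?thesis using far_antimono[OF finite_V, of 2 3 E u] by simp
  qed (use far_3 in simp)
next
  case (Suc j)
  show ?case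
  proof (cases "far V E u (2 * j + 4) = 0")
    case True
    then show ?thesis
      using far_antimono[OF finite_V, of "2 * j + 4" "2 * Suc j + 3" E u] by simp
  next
    case False
    then have "0 < far V E u (Suc (2 * j + 3))" by (simp add: eval_nat_numeral)
    from far_step[OF uconn uV this]
    have "far V E u (Suc (Suc (2 * j + 3))) + k \<le> card V - Suc j * k - card S"
      using Suc by (rule le_trans)
    then have "far V E u (Suc (Suc (2 * j + 3))) \<le> card V - Suc (Suc j) * k - card S" by simp
    moreover have "Suc (Suc (2 * j + 3)) = 2 * Suc j + 3" by simp
    ultimately show ?thesis by metis
  qed
qed

lemma far_vanish: "far V E u i < k \<Longrightarrow> far V E u (Suc i) = 0"
  using far_step[OF uconn uV, of i] by linarith

end

section \<open>Level paths\<close>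

text \<open>The common shape of all extremal hypergraphs: \<open>path_nondiv\<close> has
  \<open>t = r\<close> and \<open>m = 2 * s\<close>, and \<open>path_div\<close> has
  \<open>t = x\<close> and \<open>m = 2 * s - 1\<close>.\<close>

definition level_path :: "nat \<Rightarrow> nat \<Rightarrow> nat \<Rightarrow> 'a set \<Rightarrow> 'a set set \<Rightarrow> ('a \<Rightarrow> nat) \<Rightarrow> bool" where
  "level_path k t m V E l \<longleftrightarrow>
     (\<forall>v\<in>V. l v \<le> m) \<and>
     (\<forall>i\<le>m. card {v \<in> V. l v = i} = (if even i then t else k - t)) \<and>
     E = (\<lambda>i. {v \<in> V. l v = i \<or> l v = Suc i}) ` {..<m}"

lemma card_two_levels:
  assumes "finite V" "card {v \<in> V. l v = i} = (if even i then t else k - t)"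
    "card {v \<in> V. l v = Suc i} = (if even (Suc i) then t else k - t)" "t < k"
  shows "card {v \<in> V. l v = i \<or> l v = Suc i} = k"
proof -
  have "{v \<in> V. l v = i \<or> l v = Suc i} = {v \<in> V. l v = i} \<union> {v \<in> V. l v = Suc i}" by auto
  then have "card {v \<in> V. l v = i \<or> l v = Suc i} =
      card {v \<in> V. l v = i} + card {v \<in> V. l v = Suc i}"
    using assms(1) by (simp only:) (rule card_Un_disjoint; auto)
  then show ?thesis using assms by (cases "even i") simp_all
qed

text \<open>If \<open>y\<close> in \<open>e\<close> has the least level, then \<open>e\<close> lies
  in levels \<open>l y\<close> and \<open>Suc (l y)\<close>, which have exactly \<open>k\<close>
  vertices together. The case \<open>l y = m\<close> is impossible because a single level has fewer
  than \<open>k\<close> vertices.\<close>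

lemma clique_is_two_levels:
  assumes fin: "finite V" and t: "0 < t" "t < k" and le: "\<And>v. v \<in> V \<Longrightarrow> l v \<le> m"
    and card: "\<And>i. i \<le> m \<Longrightarrow> card {v \<in> V. l v = i} = (if even i then t else k - t)"
    and e: "e \<subseteq> V" "card e = k" and close: "\<And>x y. x \<in> e \<Longrightarrow> y \<in> e \<Longrightarrow> l x \<le> Suc (l y)"
  shows "\<exists>i<m. e = {v \<in> V. l v = i \<or> l v = Suc i}"
proof -
  obtain v where v: "v \<in> e" using e t by fastforce
  obtain y where y: "y \<in> e" "\<And>x. x \<in> e \<Longrightarrow> l y \<le> l x"
    using ex_has_least_nat[of "\<lambda>x. x \<in> e" v l] v by blast
  have sub: "e \<subseteq> {v \<in> V. l v = l y \<or> l v = Suc (l y)}"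
    using y(2) close[OF _ y(1)] e by (fastforce simp: le_Suc_eq)
  show ?thesis
  proof (cases "l y < m")
    case True
    then have "e = {v \<in> V. l v = l y \<or> l v = Suc (l y)}"
      using sub card_two_levels[OF fin card card t(2), of "l y"] e fin
      by (intro card_subset_eq) auto
    then show ?thesis using True by blast
  next
    case False
    then have "l y = m" using le[of y] y e by auto
    then have "e \<subseteq> {v \<in> V. l v = m}" using sub le by fastforce
    then have "card e \<le> card {v \<in> V. l v = m}" using fin by (intro card_mono) auto
    then show ?thesis using card[of m] e t by (auto split: if_splits)
  qed
qed

text \<open>Used to see that a level path admits no further edge without changing some
  distance.\<close>

lemma level_path_cliqueD:
  assumes "level_path k t m V E l" "finite V" "0 < t" "t < k"
    and "e \<subseteq> V" "card e = k" "\<And>x y. x \<in> e \<Longrightarrow> y \<in> e \<Longrightarrow> l x \<le> Suc (l y)"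
  shows "e \<in> E"
  using clique_is_two_levels[of V t k l m e] assms unfolding level_path_def by blast

lemma level_path_adj_le:
  assumes "level_path k t m V E l" "(u, v) \<in> adj E"
  shows "l u \<le> Suc (l v)"
  using assms by (auto simp: level_path_def adj_def)

section \<open>Distance sums from a pendant vertex and their equality case\<close>

context pendant
begin

text \<open>Joins \<open>far_even\<close> and \<open>far_odd\<close>. It is not a bound at 1, where
  \<open>far\<close> is \<open>card V - 1\<close>; therefore the sums below start at 2.\<close>

definition far_bound :: "nat \<Rightarrow> nat" where
  "far_bound i = card V - i div 2 * k - (if odd i then card S else 0)"

lemma far_le_bound:
  assumes "2 \<le> i"
  shows "far V E u i \<le> far_bound i"
proof (cases "even i")
  case True
  then obtain j where "i = 2 * Suc j" using assms
    by (metis evenE mult_0_right not0_implies_Suc not_numeral_le_zero)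
  then show ?thesis using far_even[of j] by (simp add: far_bound_def)
next
  case False
  then obtain j where "i = 2 * j + 1" by (rule oddE)
  with assms obtain j' where "i = 2 * j' + 3" by (cases j) auto
  then show ?thesis using far_odd[of j'] by (simp add: far_bound_def)
qed

lemma sum_gdist_le:
  assumes "1 \<le> m" "far V E u (Suc m) = 0"
  shows "(\<Sum>v\<in>V. gdist E u v) \<le> card V - 1 + (\<Sum>i=2..m. far_bound i)"
    and "(\<Sum>v\<in>V. gdist E u v) = card V - 1 + (\<Sum>i=2..m. far_bound i) \<Longrightarrow>
      2 \<le> i \<Longrightarrow> i \<le> m \<Longrightarrow> far V E u i = far_bound i"
proof -
  have *: "(\<Sum>v\<in>V. gdist E u v) = card V - 1 + (\<Sum>i=2..m. far V E u i)"
    using sum_gdist_eq_sum_far[OF finite_V assms(2)] assms(1) far_1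
    by (simp add: sum.atLeast_Suc_atMost numeral_2_eq_2)
  show "(\<Sum>v\<in>V. gdist E u v) \<le> card V - 1 + (\<Sum>i=2..m. far_bound i)"
    unfolding * by (intro add_left_mono sum_mono far_le_bound) auto
  show "far V E u i = far_bound i"
    if "(\<Sum>v\<in>V. gdist E u v) = card V - 1 + (\<Sum>i=2..m. far_bound i)" "2 \<le> i" "i \<le> m"
    using that unfolding *
    by (intro sum_mono_inv[of "far V E u" "{2..m}" far_bound i]) (auto intro: far_le_bound)
qed

lemma sum_gdist_le_real:
  assumes m: "1 \<le> m" and vanish: "far V E u (Suc m) = 0"
    and B: "real (card V - 1 + (\<Sum>i=2..m. far_bound i)) = B"
  shows "real (\<Sum>v\<in>V. gdist E u v) \<le> B \<and> (real (\<Sum>v\<in>V. gdist E u v) = B \<longrightarrow>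
    (\<forall>i. 2 \<le> i \<longrightarrow> i \<le> m \<longrightarrow> far V E u i = far_bound i))"
  unfolding B[symmetric] of_nat_le_iff of_nat_eq_iff
  using sum_gdist_le[OF m vanish] by blast

text \<open>Equality in every bound fixes the level sizes as differences of consecutive bounds.
  Every edge is then forced to fill two consecutive levels, and every such pair of levels contains
  an edge.\<close>

lemma level_path_of_far_eq:
  assumes m: "1 \<le> m" and t: "card S = t" "0 < t" "t < k"
    and n: "card V = Suc m div 2 * k + (if even m then t else 0)"
    and eq: "\<And>i. 2 \<le> i \<Longrightarrow> i \<le> m \<Longrightarrow> far V E u i = far_bound i"
  shows "level_path k t m V E (\<lambda>v. if v \<in> S then 0 else gdist E u v)"
proof -
  \<comment> \<open>Distance from \<open>u\<close> puts \<open>u\<close> alone on level 0 and the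
    rest of \<open>S\<close> on level 1 with \<open>e - S\<close>. Moving all of \<open>S\<close> to
    level 0 produces the sizes \<open>t\<close> and \<open>k - t\<close>.\<close>
  define l where "l = (\<lambda>v. if v \<in> S then 0 else gdist E u v)"
  have SV: "S \<subseteq> V" using S eV by blast
  \<comment> \<open>The assumed form of \<open>card V\<close> makes the bound vanish just beyond
    \<open>m\<close>, so the equalities extend to \<open>Suc m\<close> and no vertex lies beyond
    level \<open>m\<close>.\<close>
  have "far_bound (Suc m) = 0" using n t by (auto simp: far_bound_def elim!: evenE oddE)
  then have vanish: "far V E u (Suc m) = 0" using far_le_bound[of "Suc m"] m by simp
  have eq': "far V E u i = far_bound i" if "2 \<le> i" "i \<le> Suc m" for i
    using eq[of i] that vanish \<open>far_bound (Suc m) = 0\<close> by (cases "i = Suc m") auto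
  have le: "l v \<le> m" if "v \<in> V" for v
  proof -
    have "{v \<in> V. Suc m \<le> gdist E u v} = {}" using vanish finite_V by (simp add: far_def)
    then show ?thesis using that by (auto simp: l_def not_less_eq_eq)
  qed
  have gS: "gdist E u v \<le> 1" if "v \<in> e" for v
    using that by (intro gdist_adj_le) (simp add: adj_u_iff)
  have l0: "{v \<in> V. l v = 0} = S" using SV gdist_u_0 u by (auto simp: l_def)
  have l1: "{v \<in> V. l v = 1} = e - S" using S u eV gdist_u_1 by (auto simp: l_def split: if_splits)
  have step: "far_bound i = far_bound (Suc i) + (if even i then t else k - t)" if "2 \<le> i" "i \<le> m" for i
  proof -
    \<comment> \<open>This keeps the subtractions in \<open>far_bound\<close> from truncating, so
      consecutive bounds differ by exactly one level size.\<close>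
    have "Suc i div 2 * k + (if even i then t else 0) \<le> card V"
    proof (cases "i = m")
      case False
      then have "Suc (Suc i) \<le> Suc m" using that by simp
      have "Suc i div 2 * k + (if even i then t else 0) \<le> Suc (Suc i) div 2 * k"
        using t by (cases "even i") (auto elim!: evenE oddE)
      also have "\<dots> \<le> Suc m div 2 * k"
        using \<open>Suc (Suc i) \<le> Suc m\<close> by (intro mult_le_mono1 div_le_mono)
      finally show ?thesis using n by simp
    qed (simp add: n)
    then show ?thesis using t
      by (cases "even i") (auto simp: far_bound_def elim!: evenE oddE)
  qed
  have card: "card {v \<in> V. l v = i} = (if even i then t else k - t)" if "i \<le> m" for i
  proof -
    consider "i = 0" | "i = 1" | "2 \<le> i" by linarith
    then show ?thesis
    proof cases
      case 1 then show ?thesis using l0 t by simp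
    next
      case 2 then show ?thesis
        using l1 t card_e S finite_S by (simp add: card_Diff_subset)
    next
      case 3
      have "v \<in> S \<Longrightarrow> gdist E u v \<le> 1" for v using gS S by blast
      then have "{v \<in> V. l v = i} = {v \<in> V. gdist E u v = i}"
        using 3 by (fastforce simp: l_def)
      also have "\<dots> = {v \<in> V. i \<le> gdist E u v} - {v \<in> V. Suc i \<le> gdist E u v}" by auto
      also have "card \<dots> = far V E u i - far V E u (Suc i)"
        unfolding far_def using finite_V by (intro card_Diff_subset) auto
      finally have "card {v \<in> V. l v = i} = far V E u i - far V E u (Suc i)" .
      then show ?thesis using eq'[of i] eq'[of "Suc i"] step[OF 3 that] 3 that by simp
    qed
  qed
  have "E = (\<lambda>i. {v \<in> V. l v = i \<or> l v = Suc i}) ` {..<m}"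
  proof
    show "E \<subseteq> (\<lambda>i. {v \<in> V. l v = i \<or> l v = Suc i}) ` {..<m}"
    proof
      fix f assume f: "f \<in> E"
      have fV: "f \<subseteq> V" "card f = k" using uconn_edge[OF uconn f] by auto
      \<comment> \<open>\<open>gdist_step\<close> is too weak for \<open>y\<close> in
        \<open>S\<close>, where \<open>l\<close> may lower distance 1 to 0. There \<open>f\<close>
        must be \<open>e\<close>, whose vertices are all within distance 1 of
        \<open>u\<close>.\<close>
      have "l x \<le> Suc (l y)" if xy: "x \<in> f" "y \<in> f" for x y
      proof (cases "y \<in> S")
        case True
        then have "f = e" using pendant[OF f] xy by blast
        then show ?thesis using gS[of x] xy by (auto simp: l_def)
      next
        case False
        have "gdist E u x \<le> Suc (gdist E u y)"
          using xy f fV by (intro gdist_step[OF uconn_rtrancl[OF uconn uV]] adjI[of f]) auto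
        then show ?thesis using False by (auto simp: l_def)
      qed
      then have "\<exists>i<m. f = {v \<in> V. l v = i \<or> l v = Suc i}"
        by (intro clique_is_two_levels[OF finite_V t(2,3) le card fV])
      then show "f \<in> (\<lambda>i. {v \<in> V. l v = i \<or> l v = Suc i}) ` {..<m}" by blast
    qed
    show "(\<lambda>i. {v \<in> V. l v = i \<or> l v = Suc i}) ` {..<m} \<subseteq> E"
    proof clarify
      fix i assume i: "i < m"
      show "{v \<in> V. l v = i \<or> l v = Suc i} \<in> E"
      proof (cases "i = 0")
        case True
        have "{v \<in> V. l v = 0 \<or> l v = 1} = {v \<in> V. l v = 0} \<union> {v \<in> V. l v = 1}" by blast
        also have "\<dots> = e" unfolding l0 l1 using S by blast
        finally show ?thesis using e True by simp
      next
        case False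
        \<comment> \<open>A vertex on level \<open>Suc i\<close> is reached by an edge inside levels
          \<open>i\<close> and \<open>Suc i\<close>; having \<open>k\<close> vertices, this edge
          fills both levels.\<close>
        have "card {v \<in> V. l v = Suc i} \<noteq> 0" using card[of "Suc i"] i t by simp
        then obtain w where w: "w \<in> V" "l w = Suc i" by (auto simp: card_eq_0_iff)
        then have dw: "gdist E u w = Suc i" by (auto simp: l_def split: if_splits)
        obtain f where f: "f \<in> E" "w \<in> f"
            "\<And>x. x \<in> f \<Longrightarrow> gdist E u x = i \<or> gdist E u x = Suc i"
          using edge_between_levels[OF uconn uV w(1) dw] by blast
        have fV: "f \<subseteq> V" "card f = k" using uconn_edge[OF uconn f(1)] by auto
        have "f \<noteq> e" using gS[of w] f(2) dw False by auto
        then have "f \<inter> S = {}" using pendant f(1) by blast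
        then have "f \<subseteq> {v \<in> V. l v = i \<or> l v = Suc i}"
          using f(3) fV by (auto simp: l_def)
        then have "f = {v \<in> V. l v = i \<or> l v = Suc i}"
          using fV card_two_levels[OF finite_V card card t(3), of i] i finite_V
          by (intro card_subset_eq) auto
        then show ?thesis using f by simp
      qed
    qed
  qed
  then show ?thesis unfolding level_path_def l_def[symmetric] using le card by blast
qed

text \<open>The range ends where the case \<open>r < card S\<close> needs it; otherwise the term for
  \<open>2 * s\<close>, which equals \<open>r\<close>, is added afterwards. The sum is evaluated two
  terms at a time.\<close>

lemma sum_far_bound:
  assumes n: "card V = k * s + r" and s: "1 \<le> s" and t: "card S \<le> k"
  shows "real (card V - 1 + (\<Sum>i=2..2 * s - 1. far_bound i)) =
    k * s\<^sup>2 + (2 * real s - 1) * r - (real s - 1) * card S - 1"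
proof -
  obtain p where p: "s = Suc p" using s by (cases s) auto
  have "(\<Sum>i=2..2 * q + 1. real (far_bound i)) =
      2 * real q * card V - k * q * (q + 1) - q * card S" if "q \<le> p" for q
    using that
  proof (induction q)
    case (Suc q)
    have "{2..2 * Suc q + 1} = insert (2 * q + 2) (insert (2 * q + 3) {2..2 * q + 1})" by auto
    then have "(\<Sum>i=2..2 * Suc q + 1. real (far_bound i)) =
        real (far_bound (2 * q + 2)) + real (far_bound (2 * q + 3)) +
        (\<Sum>i=2..2 * q + 1. real (far_bound i))" by simp
    \<comment> \<open>Writing \<open>p = Suc q + c\<close> shows that \<open>card V\<close> exceeds
      \<open>Suc q * k\<close> by at least \<open>k\<close>, hence by at least
      \<open>card S\<close>, so both subtractions are exact.\<close>
    moreover obtain c where c: "p = Suc q + c" using Suc.prems le_Suc_ex by blast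
    have "card V = Suc q * k + (k + c * k + r)" by (simp add: n p c algebra_simps)
    then have "real (far_bound (2 * q + 2)) = real (card V) - Suc q * real k"
      "real (far_bound (2 * q + 3)) = real (card V) - Suc q * real k - card S"
      using t by (auto simp: far_bound_def of_nat_diff algebra_simps)
    ultimately show ?case using Suc by (simp add: algebra_simps)
  qed simp
  from this[of p] have *: "(\<Sum>i=2..2 * s - 1. real (far_bound i)) =
      2 * real p * card V - k * p * (p + 1) - p * card S" using p by simp
  have "0 < card V" using uV finite_V by (auto simp: card_gt_0_iff)
  then have "real (card V - 1) = real (card V) - 1" by (simp add: of_nat_diff)
  then show ?thesis unfolding of_nat_add of_nat_sum * using n p
    by (simp add: algebra_simps power2_eq_square)
qed

end

section \<open>The upper bound\<close>

text \<open>Twice the Wiener index of the extremal hypergraphs with \<open>n = k s + r\<close>. The formula is also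
  valid for \<open>r = k\<close>, where it agrees with the value for \<open>s + 1\<close> and \<open>0\<close>.\<close>

definition max_dist_sum :: "real \<Rightarrow> real \<Rightarrow> real \<Rightarrow> real" where
  "max_dist_sum k s r = s * k * (k - 1) + 2 * k\<^sup>2 * (s ^ 3 - s) / 3 + r * (r - 1) +
     2 * r * k * s * (s + 1) - 2 * s * r * (k - r)"

text \<open>Leaf removal with \<open>t \<le> r\<close>. The middle term
  \<open>t * (2 * B - (t - 1))\<close> is the contribution of \<open>t\<close> pendant vertices with
  distance sum \<open>B\<close>; the last term is the slack.\<close>

lemma max_dist_sum_diff_le:
  "max_dist_sum k s r = max_dist_sum k s (r - t) +
     t * (2 * (k * s\<^sup>2 + 2 * s * r - (s - 1) * t - 1) - (t - 1)) + 2 * t * (r - t)"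
  by (simp add: max_dist_sum_def power2_eq_square power3_eq_cube field_simps)

text \<open>Leaf removal with \<open>t > r\<close>, where the remainder borrows \<open>k\<close>
  from the quotient. Here \<open>B\<close> lacks one summand \<open>r\<close>, the term for distance
  \<open>2 * s\<close>.\<close>

lemma max_dist_sum_diff_gt:
  "max_dist_sum k s r = max_dist_sum k (s - 1) (k + r - t) +
     t * (2 * (k * s\<^sup>2 + (2 * s - 1) * r - (s - 1) * t - 1) - (t - 1)) + 2 * r\<^sup>2"
  by (simp add: max_dist_sum_def power2_eq_square power3_eq_cube field_simps)

text \<open>Twice the row sums over \<open>V - K\<close> account for mixed pairs in both orders, but
  count the pairs inside \<open>V - K\<close> twice over; these have distance 1, hence the
  correction.\<close>

lemma dist_sum_split:
  assumes "finite V" "K \<subseteq> V"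
    and S: "\<And>u v. u \<in> V - K \<Longrightarrow> v \<in> V - K \<Longrightarrow> u \<noteq> v \<Longrightarrow> gdist E u v = 1"
  shows "(\<Sum>u\<in>V. \<Sum>v\<in>V. real (gdist E u v)) = (\<Sum>u\<in>K. \<Sum>v\<in>K. real (gdist E u v)) +
    (\<Sum>u\<in>V - K. 2 * (\<Sum>v\<in>V. real (gdist E u v)) - (real (card (V - K)) - 1))"
proof -
  let ?d = "\<lambda>u v. real (gdist E u v)"
  have split: "sum f V = sum f K + sum f (V - K)" for f :: "_ \<Rightarrow> real"
    using assms(1,2) by (simp add: sum.subset_diff)
  have row: "(\<Sum>v\<in>V - K. ?d u v) = real (card (V - K)) - 1" if u: "u \<in> V - K" for u
  proof -
    have "(\<Sum>v\<in>V - K. ?d u v) = (\<Sum>v\<in>V - K - {u}. ?d u v)"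
      using assms(1) u by (subst sum.remove[of _ u]) auto
    also have "\<dots> = (\<Sum>v\<in>V - K - {u}. 1)" using S[OF u] by (intro sum.cong) auto
    moreover have "card (V - K) = Suc (card (V - K - {u}))"
      using assms(1) u by (intro card.remove) auto
    ultimately show ?thesis by simp
  qed
  have "(\<Sum>u\<in>V. \<Sum>v\<in>V. ?d u v) =
      (\<Sum>u\<in>K. \<Sum>v\<in>K. ?d u v) + (\<Sum>u\<in>K. \<Sum>v\<in>V - K. ?d u v) + (\<Sum>u\<in>V - K. \<Sum>v\<in>V. ?d u v)"
    unfolding split[of "\<lambda>u. \<Sum>v\<in>V. ?d u v"] by (simp add: split sum.distrib)
  also have "(\<Sum>u\<in>K. \<Sum>v\<in>V - K. ?d u v) = (\<Sum>u\<in>V - K. \<Sum>v\<in>K. ?d u v)"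
    by (subst sum.swap) (simp add: gdist_sym)
  also have "\<dots> = (\<Sum>u\<in>V - K. (\<Sum>v\<in>V. ?d u v) - (real (card (V - K)) - 1))"
    by (intro sum.cong refl) (simp add: split row)
  finally show ?thesis by (simp add: sum_subtractf sum_distrib_left[symmetric])
qed

lemma dist_sum_single_edge:
  assumes H: "uconn k V E" and n: "card V = k" and k: "2 \<le> k"
  shows "real (dist_sum V E) = max_dist_sum k 1 0" "E = {V}"
proof -
  have fin: "finite V" by (rule uconn_finite[OF H])
  have "e = V" if "e \<in> E" for e
    using uconn_edge[OF H that] n card_subset_eq[OF fin] by simp
  moreover have "\<not> card V \<le> Suc 0" using n k by simp
  then obtain a b where ab: "a \<in> V" "b \<in> V" "a \<noteq> b"
    using card_le_Suc0_iff_eq[OF fin] by blast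
  then have "E \<noteq> {}" using uconn_rtrancl[OF H ab(1,2)] by (auto simp: adj_def)
  ultimately show E: "E = {V}" by blast
  have "gdist E u v = 1" if "u \<in> V" "v \<in> V" "u \<noteq> v" for u v
    using gdist_eq_1_iff[OF H, of u v] that E by (auto simp: adj_def)
  then have "(\<Sum>v\<in>V - {u}. real (gdist E u v)) = (\<Sum>v\<in>V - {u}. 1)" if "u \<in> V" for u
    using that by (intro sum.cong) auto
  then have "(\<Sum>v\<in>V. real (gdist E u v)) = (\<Sum>v\<in>V - {u}. 1)" if "u \<in> V" for u
    using that sum.remove[OF fin that, of "\<lambda>v. real (gdist E u v)"] by simp
  then have "(\<Sum>v\<in>V. real (gdist E u v)) = real k - 1" if "u \<in> V" for u
    using that fin n k by (simp add: of_nat_diff)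
  then show "real (dist_sum V E) = max_dist_sum k 1 0"
    by (simp add: dist_sum_def n max_dist_sum_def)
qed

text \<open>Strong induction on the number of edges, with three cases: a single edge, an edge whose
  deletion keeps the hypergraph connected, and a leaf edge. The equality case leaves
  \<open>t\<close> and \<open>m\<close> open; \<open>level_count_cases\<close> later relates them to
  \<open>s\<close> and \<open>r\<close>.\<close>

theorem dist_sum_le:
  assumes "uconn k V E" "2 \<le> k" "card V = k * s + r" "r < k" "1 \<le> s"
  shows "real (dist_sum V E) \<le> max_dist_sum k s r \<and>
    (real (dist_sum V E) = max_dist_sum k s r \<longrightarrow>
      (\<exists>t m l. 0 < t \<and> t < k \<and> card V = Suc m div 2 * k + (if even m then t else 0) \<and>
        level_path k t m V E l))"
  using assms
proof (induction "card E" arbitrary: V E s r rule: less_induct)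
  case less
  note H = less.prems(1) and k = less.prems(2) and n = less.prems(3) and r = less.prems(4)
    and s = less.prems(5)
  have fin: "finite V" by (rule uconn_finite[OF H])
  have finE: "finite E" by (rule uconn_finite_edges[OF H])
  show ?case
  proof (cases "card V = k")
    case True
    have sr: "s = 1" "r = 0"
    proof -
      obtain p where p: "s = Suc p" using s by (cases s) auto
      then show "s = 1" "r = 0" using n True k by auto
    qed
    obtain a where a: "a \<in> V" using True k by fastforce
    \<comment> \<open>The single edge is a level path with \<open>t = m = 1\<close>: one vertex on
      level 0, the others on level 1.\<close>
    define l where "l = (\<lambda>v. if v = a then 0 else Suc 0)"
    have l: "l v = 0 \<or> l v = Suc 0" for v by (simp add: l_def)
    have "card {v \<in> V. l v = i} = (if even i then 1 else k - 1)" if "i \<le> 1" for i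
    proof -
      have "{v \<in> V. l v = i} = (if i = 0 then {a} else V - {a})"
        using that a by (auto simp: l_def)
      then show ?thesis using that a True fin by (cases "i = 0") (auto simp: le_Suc_eq)
    qed
    moreover have "l v \<le> 1" for v using l[of v] by auto
    moreover have "{..<1} = {0::nat}" by auto
    ultimately have "level_path k 1 1 V E l"
      using dist_sum_single_edge(2)[OF H True k] l unfolding level_path_def by simp
    moreover have "card V = Suc 1 div 2 * k + (if even (1::nat) then 1 else 0)"
      using True by simp
    ultimately show ?thesis
      using dist_sum_single_edge(1)[OF H True k] k sr
      by (intro conjI impI exI[of _ 1]) auto
  next
    case False
    then have nk: "k < card V" using n s k
      by (metis le_add1 le_neq_implies_less mult.right_neutral mult_le_mono2 order_trans)
    show ?thesis
    proof (cases "\<exists>e\<in>E. uconn k V (E - {e})")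
      case True
      then obtain e where e: "e \<in> E" "uconn k V (E - {e})" by blast
      have "card (E - {e}) < card E" using e finE by (intro psubset_card_mono) auto
      note IH = less.hyps[OF this e(2) k n r s]
      have mono: "gdist E u v \<le> gdist (E - {e}) u v" if "u \<in> V" "v \<in> V" for u v
        using that by (intro gdist_antimono uconn_rtrancl[OF e(2)]) auto
      then have le: "dist_sum V E \<le> dist_sum V (E - {e})"
        unfolding dist_sum_def by (intro sum_mono) auto
      \<comment> \<open>Equality would pass to \<open>E - {e}\<close> with all distances unchanged.
        The vertices of \<open>e\<close> would then be pairwise adjacent without \<open>e\<close>,
        hence at most one level apart, and \<open>e\<close> would already be an edge of the level
        path \<open>E - {e}\<close>.\<close>
      have "real (dist_sum V E) \<noteq> max_dist_sum k s r"
      proof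
        assume eq: "real (dist_sum V E) = max_dist_sum k s r"
        then have eq': "dist_sum V E = dist_sum V (E - {e})" using IH le by linarith
        then obtain t m l where tm: "0 < t" "t < k" "level_path k t m V (E - {e}) l"
          using IH eq by metis
        have row: "(\<Sum>v\<in>V. gdist E u v) = (\<Sum>v\<in>V. gdist (E - {e}) u v)" if "u \<in> V" for u
          using eq' that fin mono unfolding dist_sum_def
          by (intro sum_mono_inv[of "\<lambda>u. \<Sum>v\<in>V. gdist E u v" V
                "\<lambda>u. \<Sum>v\<in>V. gdist (E - {e}) u v" u]) (auto intro: sum_mono)
        have same: "gdist E u v = gdist (E - {e}) u v" if "u \<in> V" "v \<in> V" for u v
          using row that fin mono
          by (intro sum_mono_inv[of "gdist E u" V "gdist (E - {e}) u" v]) auto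
        have eV: "e \<subseteq> V" "card e = k" using uconn_edge[OF H e(1)] by auto
        have "l x \<le> Suc (l y)" if xy: "x \<in> e" "y \<in> e" for x y
        proof (cases "x = y")
          case False
          then have "gdist E x y = 1"
            using gdist_eq_1_iff[OF H, of x y] xy eV adjI[OF e(1)] by blast
          then have "(x, y) \<in> adj (E - {e})"
            using gdist_eq_1_iff[OF e(2), of x y] same[of x y] xy eV by auto
          then show ?thesis by (rule level_path_adj_le[OF tm(3)])
        qed simp
        then have "e \<in> E - {e}" by (intro level_path_cliqueD[OF tm(3) fin tm(1,2) eV])
        then show False by blast
      qed
      then show ?thesis using IH le by auto
    next
      case False
      have "E \<noteq> {}"
      proof
        assume "E = {}"
        then have "card V \<le> 1"
          using uconn_rtrancl[OF H] fin by (auto simp: card_le_Suc0_iff_eq adj_def)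
        then show False using nk k by simp
      qed
      moreover have "V \<noteq> {}" using nk by auto
      ultimately obtain e K where eK: "e \<in> E" "K \<subset> V" "e \<inter> K \<noteq> {}" "V - K \<subseteq> e"
          and inK: "\<And>f. f \<in> E \<Longrightarrow> f \<noteq> e \<Longrightarrow> f \<subseteq> K" and C: "uconn k K (E - {e})"
        using leaf_edge_exists[OF H] False by metis
      define t where "t = card (V - K)"
      have ecard: "card e = k" "e \<subseteq> V" using uconn_edge[OF H eK(1)] by auto
      have fine: "finite e" using ecard fin by (auto intro: finite_subset)
      have t: "0 < t" "t < k"
      proof -
        show "0 < t" using eK(2) fin by (auto simp: t_def card_gt_0_iff)
        have "V - K \<subset> e" using eK by blast
        then show "t < k" using fine ecard unfolding t_def by (metis psubset_card_mono)
      qed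
      have cardK: "card K + t = card V"
      proof -
        have "K \<subseteq> V" using eK(2) by blast
        then have "finite K" "card K \<le> card V" using fin by (auto intro: finite_subset card_mono)
        then show ?thesis using \<open>K \<subseteq> V\<close> by (simp add: t_def card_Diff_subset)
      qed
      \<comment> \<open>Some vertex lies outside \<open>e\<close>, and any edge through it is
        contained in \<open>K\<close>. So \<open>K\<close> is large enough for the induction
        hypothesis.\<close>
      have Kk: "k \<le> card K"
      proof -
        obtain w where w: "w \<in> V" "w \<notin> e" using nk ecard fine
          by (metis card_mono leD subsetI)
        obtain a where a: "a \<in> e" using ecard k by fastforce
        then have "(a, w) \<in> (adj E)\<^sup>*" "a \<noteq> w"
          using uconn_rtrancl[OF H, of a w] w ecard by auto
        then obtain w' where "(w', w) \<in> adj E" by (auto elim: rtranclE)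
        then obtain f where f: "f \<in> E" "w \<in> f" by (auto simp: adj_def)
        then have "f \<noteq> e" using w by blast
        then have "f \<subseteq> K" using inK f by blast
        then show ?thesis using uconn_edge[OF H f(1)] fin eK(2)
          by (metis card_mono finite_subset psubset_imp_subset)
      qed
      have pend: "pendant k V E e (V - K) u" if "u \<in> V - K" for u
        using H eK inK that by unfold_locales auto
      have cardE: "card (E - {e}) < card E" using eK(1) finE by (intro psubset_card_mono) auto
      have DK: "(\<Sum>u\<in>K. \<Sum>v\<in>K. real (gdist E u v)) \<le> real (dist_sum K (E - {e}))"
        unfolding dist_sum_def of_nat_sum
        by (intro sum_mono of_nat_mono gdist_antimono uconn_rtrancl[OF C]) auto
      define T where "T = (\<lambda>u. \<Sum>v\<in>V. gdist E u v)"
      have D: "real (dist_sum V E) = (\<Sum>u\<in>K. \<Sum>v\<in>K. real (gdist E u v)) +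
          (\<Sum>u\<in>V - K. 2 * real (T u) - (real t - 1))"
      proof -
        have "gdist E u v = 1" if "u \<in> V - K" "v \<in> V - K" "u \<noteq> v" for u v
          using gdist_eq_1_iff[OF H, of u v] that eK adjI[OF eK(1), of u v] by blast
        then show ?thesis
          using dist_sum_split[OF fin, of K E] eK(2) by (simp add: T_def t_def dist_sum_def)
      qed
      \<comment> \<open>Shared by both cases below: \<open>B\<close> bounds the distance sums of the
        removed vertices, \<open>M'\<close> bounds the distance sum of \<open>K\<close>, and
        \<open>X\<close> is the slack. Equality makes every estimate tight.\<close>
      have combine: "real (dist_sum V E) \<le> M \<and> (real (dist_sum V E) = M \<longrightarrow>
          X = 0 \<and> (\<forall>u\<in>V - K. real (T u) = B))"
        if B: "\<And>u. u \<in> V - K \<Longrightarrow> real (T u) \<le> B" and X: "0 \<le> X"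
          and C: "real (dist_sum K (E - {e})) \<le> M'"
          and M: "M = M' + real t * (2 * B - (real t - 1)) + X" for B M M' X
      proof -
        have "(\<Sum>u\<in>V - K. 2 * real (T u) - (real t - 1)) \<le> (\<Sum>u\<in>V - K. 2 * B - (real t - 1))"
          using B by (intro sum_mono) auto
        moreover have *: "(\<Sum>u\<in>V - K. 2 * B - (real t - 1)) = real t * (2 * B - (real t - 1))"
          by (simp add: t_def)
        ultimately have le: "real (dist_sum V E) \<le> M" using D DK C M X by linarith
        moreover have "X = 0 \<and> (\<forall>u\<in>V - K. real (T u) = B)" if eq: "real (dist_sum V E) = M"
        proof
          show "X = 0"
            using \<open>(\<Sum>u\<in>V - K. 2 * real (T u) - (real t - 1)) \<le> _\<close> * D DK C M X eq by linarith
          have sumeq: "(\<Sum>u\<in>V - K. 2 * real (T u) - (real t - 1)) =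
              (\<Sum>u\<in>V - K. 2 * B - (real t - 1))"
            using \<open>(\<Sum>u\<in>V - K. 2 * real (T u) - (real t - 1)) \<le> _\<close> * D DK C M X eq by linarith
          show "\<forall>u\<in>V - K. real (T u) = B"
          proof
            fix u assume "u \<in> V - K"
            then have "2 * real (T u) - (real t - 1) = 2 * B - (real t - 1)"
              using B fin by (intro sum_mono_inv[OF sumeq]) auto
            then show "real (T u) = B" by simp
          qed
        qed
        ultimately show ?thesis by blast
      qed
      obtain u where u: "u \<in> V - K" using eK(2) by blast
      interpret P: pendant k V E e "V - K" u by (rule pend[OF u])
      \<comment> \<open>With \<open>s = 1\<close> nothing can be borrowed: \<open>K\<close> would
        have only \<open>k + r - t < k\<close> vertices.\<close>
      have s2: "r < t \<Longrightarrow> 2 \<le> s"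
      proof (rule ccontr)
        assume "r < t" "\<not> 2 \<le> s"
        then have "s = 1" using s by simp
        then show False using n cardK Kk \<open>r < t\<close> by simp
      qed
      show ?thesis
      proof (cases "t \<le> r")
        case True
        define B where "B = real k * (real s)\<^sup>2 + 2 * real s * r - (real s - 1) * t - 1"
        have bound: "real (T v) \<le> B \<and> (real (T v) = B \<longrightarrow>
            (\<forall>i. 2 \<le> i \<longrightarrow> i \<le> 2 * s \<longrightarrow> far V E v i = card V - i div 2 * k - (if odd i then t else 0)))"
          if v: "v \<in> V - K" for v
        proof -
          interpret Q: pendant k V E e "V - K" v by (rule pend[OF v])
          \<comment> \<open>Fewer than \<open>k\<close> vertices remain at distance
            \<open>2 * s\<close> or more, too few for a further level.\<close>
          have "far V E v (2 * s) \<le> r" using Q.far_even[of "s - 1"] s n by (simp add: mult.commute)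
          then have vanish: "far V E v (Suc (2 * s)) = 0" using r by (intro Q.far_vanish) simp
          have "{2..2 * s} = insert (2 * s) {2..2 * s - 1}" using s by auto
          moreover have "2 * s \<notin> {2..2 * s - 1}" using s by auto
          moreover have "Q.far_bound (2 * s) = r" using n by (simp add: Q.far_bound_def mult.commute)
          ultimately have "real (card V - 1 + (\<Sum>i=2..2 * s. Q.far_bound i)) = B"
            using Q.sum_far_bound[OF n s] t unfolding B_def t_def by (simp add: algebra_simps)
          moreover have m: "1 \<le> 2 * s" using s by simp
          ultimately show ?thesis
            using Q.sum_gdist_le_real[OF m vanish] unfolding T_def Q.far_bound_def t_def by blast
        qed
        have rt: "card K = k * s + (r - t)" using cardK n True by simp
        note IH = less.hyps[OF cardE C k rt _ s]
        have "real (dist_sum K (E - {e})) \<le> max_dist_sum k s (real r - real t)"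
          using IH r True by (simp add: of_nat_diff)
        moreover have "0 \<le> 2 * real t * (real r - real t)" using True by simp
        ultimately have res: "real (dist_sum V E) \<le> max_dist_sum k s r \<and>
            (real (dist_sum V E) = max_dist_sum k s r \<longrightarrow>
              2 * real t * (real r - real t) = 0 \<and> (\<forall>u\<in>V - K. real (T u) = B))"
          using bound max_dist_sum_diff_le[of k s r t]
          by (intro combine) (auto simp: B_def)
        have "level_path k t (2 * s) V E (\<lambda>v. if v \<in> V - K then 0 else gdist E u v) \<and>
            card V = Suc (2 * s) div 2 * k + (if even (2 * s) then t else 0)"
          if eq: "real (dist_sum V E) = max_dist_sum k s r"
        proof -
          \<comment> \<open>The slack \<open>2 * t * (r - t)\<close> vanishes and \<open>t\<close>
            is positive.\<close>
          have "r = t" "real (T u) = B" using res eq t u by auto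
          then have nt: "card V = Suc (2 * s) div 2 * k + (if even (2 * s) then t else 0)"
            using n by (simp add: mult.commute)
          moreover have "1 \<le> 2 * s" using s by simp
          ultimately show ?thesis
            using bound[OF u] \<open>real (T u) = B\<close> t s
            by (intro conjI P.level_path_of_far_eq) (auto simp: P.far_bound_def t_def)
        qed
        then show ?thesis using res t by blast
      next
        case False
        define B where "B = real k * (real s)\<^sup>2 + (2 * real s - 1) * r - (real s - 1) * t - 1"
        have s2: "2 \<le> s" using s2 False by simp
        have bound: "real (T v) \<le> B \<and> (real (T v) = B \<longrightarrow>
            (\<forall>i. 2 \<le> i \<longrightarrow> i \<le> 2 * s - 1 \<longrightarrow> far V E v i = card V - i div 2 * k - (if odd i then t else 0)))"
          if v: "v \<in> V - K" for v
        proof -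
          interpret Q: pendant k V E e "V - K" v by (rule pend[OF v])
          obtain p where p: "s = Suc (Suc p)" using s2 by (metis One_nat_def Suc_1 Suc_le_D Suc_le_mono)
          \<comment> \<open>As \<open>2 * p + 3 = 2 * s - 1\<close>, at most
            \<open>k + r - t < k\<close> vertices are this far away, so distances end at
            \<open>2 * s - 1\<close>.\<close>
          have "far V E v (2 * p + 3) \<le> k + r - t" using Q.far_odd[of p] n
            by (simp add: p t_def algebra_simps)
          then have "far V E v (2 * p + 3) < k" using False k by linarith
          then have "far V E v (Suc (2 * p + 3)) = 0" by (rule Q.far_vanish)
          then have vanish: "far V E v (Suc (2 * s - 1)) = 0" by (simp add: p eval_nat_numeral)
          have m: "1 \<le> 2 * s - 1" using s by simp
          have "real (card V - 1 + (\<Sum>i=2..2 * s - 1. Q.far_bound i)) = B"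
            using Q.sum_far_bound[OF n s] t unfolding B_def t_def by simp
          then show ?thesis
            using Q.sum_gdist_le_real[OF m vanish] unfolding T_def Q.far_bound_def t_def by blast
        qed
        obtain p where p: "s = Suc p" using s by (cases s) auto
        have rt: "card K = k * (s - 1) + (k + r - t)"
          using cardK n t by (simp add: p)
        have "k + r - t < k" "1 \<le> s - 1" using False s2 k by auto
        note IH = less.hyps[OF cardE C k rt this]
        have "real (dist_sum K (E - {e})) \<le> max_dist_sum k (real s - 1) (real k + real r - real t)"
          using IH s t by (simp add: of_nat_diff)
        then have res: "real (dist_sum V E) \<le> max_dist_sum k s r \<and>
            (real (dist_sum V E) = max_dist_sum k s r \<longrightarrow>
              2 * (real r)\<^sup>2 = 0 \<and> (\<forall>u\<in>V - K. real (T u) = B))"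
          using bound max_dist_sum_diff_gt[of k s r t]
          by (intro combine) (auto simp: B_def)
        have "level_path k t (2 * s - 1) V E (\<lambda>v. if v \<in> V - K then 0 else gdist E u v) \<and>
            card V = Suc (2 * s - 1) div 2 * k + (if even (2 * s - 1) then t else 0)"
          if eq: "real (dist_sum V E) = max_dist_sum k s r"
        proof -
          \<comment> \<open>The slack \<open>2 * r^2\<close> vanishes. It puts no condition on
            \<open>t\<close>, which is why a whole family is extremal.\<close>
          have "r = 0" "real (T u) = B" using res eq t u by auto
          then have nt: "card V = Suc (2 * s - 1) div 2 * k + (if even (2 * s - 1) then t else 0)"
            using n s by (simp add: mult.commute)
          moreover have "1 \<le> 2 * s - 1" using s by simp
          ultimately show ?thesis
            using bound[OF u] \<open>real (T u) = B\<close> t s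
            by (intro conjI P.level_path_of_far_eq) (auto simp: P.far_bound_def t_def)
        qed
        then show ?thesis using res t by blast
      qed
    qed
  qed
qed

section \<open>Level paths attain the bound\<close>

lemma level_path_uconn:
  assumes L: "level_path k t m V E l" and fin: "finite V" and t: "0 < t" "t < k" and m: "1 \<le> m"
  shows "uconn k V E"
proof -
  have card: "card {v \<in> V. l v = i} = (if even i then t else k - t)" if "i \<le> m" for i
    using L that by (simp add: level_path_def)
  have le: "l v \<le> m" if "v \<in> V" for v using L that by (simp add: level_path_def)
  have E: "{v \<in> V. l v = i \<or> l v = Suc i} \<in> E" if "i < m" for i
    using L that by (auto simp: level_path_def)
  have ex: "\<exists>v\<in>V. l v = i" if "i \<le> m" for i
  proof -
    have "card {v \<in> V. l v = i} \<noteq> 0" using card[OF that] t by simp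
    then show ?thesis by (auto simp: card_eq_0_iff)
  qed
  have to_0: "(v, w) \<in> (adj E)\<^sup>*" if "v \<in> V" "w \<in> V" "l v = i" "l w = 0" for v w i
    using that
  proof (induction i arbitrary: v)
    case 0
    then have "(v, w) \<in> adj E" using m by (intro adjI[OF E[of 0]]) auto
    then show ?case by blast
  next
    case (Suc i)
    then have i: "Suc i \<le> m" using le by metis
    then obtain x where x: "x \<in> V" "l x = i" using ex[of i] by auto
    have "(v, x) \<in> adj E" using i x Suc by (intro adjI[OF E[of i]]) auto
    then show ?case using Suc.IH[OF x(1) Suc.prems(2) x(2) Suc.prems(4)] by (rule converse_rtrancl_into_rtrancl)
  qed
  obtain w where w: "w \<in> V" "l w = 0" using ex[of 0] by auto
  have "(u, v) \<in> (adj E)\<^sup>*" if "u \<in> V" "v \<in> V" for u v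
    using to_0[OF that(1) w(1) refl w(2)] rtrancl_adj_sym[OF to_0[OF that(2) w(1) refl w(2)]]
    by (rule rtrancl_trans)
  moreover have "e \<subseteq> V \<and> card e = k" if e: "e \<in> E" for e
  proof -
    obtain i where i: "i < m" "e = {v \<in> V. l v = i \<or> l v = Suc i}"
      using L e by (auto simp: level_path_def)
    then show ?thesis using card_two_levels[OF fin card card t(2), of i] by auto
  qed
  ultimately show ?thesis using fin by (auto simp: uconn_def)
qed

lemma level_path_gdist_ge:
  assumes L: "level_path k t m V E l" and uv: "(u, v) \<in> (adj E)\<^sup>*"
  shows "\<bar>real (l u) - real (l v)\<bar> \<le> real (gdist E u v)"
proof -
  have "l u \<le> l v + d \<and> l v \<le> l u + d" if "(u, v) \<in> adj E ^^ d" for d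
    using that
  proof (induction d arbitrary: v)
    case (Suc d)
    then obtain x where x: "(u, x) \<in> adj E ^^ d" "(x, v) \<in> adj E" by auto
    have "(v, x) \<in> adj E" using x(2) sym_adj by (metis symD)
    then show ?case using Suc.IH[OF x(1)] level_path_adj_le[OF L] x(2) by fastforce
  qed simp
  from this[OF gdist_walk[OF uv]] show ?thesis by linarith
qed

lemma double_sum_Un:
  fixes d :: "'a \<Rightarrow> 'a \<Rightarrow> real"
  assumes "finite X" "finite Y" "X \<inter> Y = {}" "\<And>u v. d u v = d v u"
  shows "(\<Sum>u\<in>X \<union> Y. \<Sum>v\<in>X \<union> Y. d u v) = (\<Sum>u\<in>X. \<Sum>v\<in>X. d u v) +
    2 * (\<Sum>u\<in>Y. \<Sum>v\<in>X. d u v) + (\<Sum>u\<in>Y. \<Sum>v\<in>Y. d u v)"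
proof -
  have "(\<Sum>u\<in>X. \<Sum>v\<in>Y. d u v) = (\<Sum>u\<in>Y. \<Sum>v\<in>X. d u v)"
    by (subst sum.swap) (simp add: assms(4))
  then show ?thesis using assms(1-3) by (simp add: sum.union_disjoint sum.distrib)
qed

text \<open>Only this inequality has to be computed, since \<open>dist_sum_le\<close> supplies the
  other. Distances are at least the level difference, and at least 1 between distinct vertices.
  \<open>p\<close> is the parity of the number \<open>Suc m\<close> of levels; for
  \<open>p = 1\<close> the last level has \<open>t\<close> vertices.\<close>

lemma level_path_dist_sum_ge:
  assumes L: "level_path k t m V E l" and fin: "finite V" and t: "0 < t" "t < k"
    and H: "uconn k V E" and m: "Suc m = 2 * s + p" "p \<le> 1"
  shows "max_dist_sum k s (p * t) \<le> real (dist_sum V E)"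
proof -
  define d where "d = (\<lambda>u v. if u = v then 0 else max 1 \<bar>real (l u) - real (l v)\<bar>)"
  have sym: "d u v = d v u" for u v by (auto simp: d_def abs_minus_commute)
  define X where "X = (\<lambda>i. {v \<in> V. l v < i})"
  \<comment> \<open>\<open>a i\<close> is the size of level \<open>i\<close>. Adding level
    \<open>i\<close> to the levels below it adds \<open>2 * a i * B i\<close> for mixed pairs and
    \<open>a i * (a i - 1)\<close> inside the level, where \<open>B i\<close> is the total level
    difference from one vertex of level \<open>i\<close>.\<close>
  define a where "a = (\<lambda>i::nat. if even i then real t else real k - real t)"
  define A where "A = (\<lambda>i. \<Sum>u\<in>X i. \<Sum>v\<in>X i. d u v)"
  define B where "B = (\<lambda>i. \<Sum>v\<in>X i. real i - real (l v))"
  have finX: "finite (X i)" for i using fin by (simp add: X_def)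
  have card: "real (card {v \<in> V. l v = i}) = a i" if "i \<le> m" for i
    using L that t by (auto simp: level_path_def a_def of_nat_diff)
  have XS: "X (Suc i) = X i \<union> {v \<in> V. l v = i}" "X i \<inter> {v \<in> V. l v = i} = {}" for i
    by (auto simp: X_def)
  have N: "real (card (X (Suc i))) = real (card (X i)) + a i" if "i \<le> m" for i
    unfolding XS(1) using finX fin XS(2) card[OF that] by (simp add: card_Un_disjoint)
  have B_Suc: "B (Suc i) = B i + real (card (X (Suc i)))" if "i \<le> m" for i
  proof -
    have "B (Suc i) = (\<Sum>v\<in>X i. real (Suc i) - real (l v)) + (\<Sum>v\<in>{v \<in> V. l v = i}. 1)"
      unfolding B_def XS(1) using finX fin XS(2) by (simp add: sum.union_disjoint)
    also have "(\<Sum>v\<in>X i. real (Suc i) - real (l v)) = B i + real (card (X i))"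
      by (simp add: B_def sum_subtractf sum.distrib algebra_simps)
    finally show ?thesis using N[OF that] card[OF that] by simp
  qed
  have A_Suc: "A (Suc i) = A i + 2 * a i * B i + a i * (a i - 1)" if "i \<le> m" for i
  proof -
    let ?Y = "{v \<in> V. l v = i}"
    have "(\<Sum>v\<in>X i. d u v) = B i" if "u \<in> ?Y" for u
      unfolding B_def using that by (intro sum.cong) (auto simp: d_def X_def)
    then have "(\<Sum>u\<in>?Y. \<Sum>v\<in>X i. d u v) = a i * B i"
      using card[OF that] by simp
    moreover have "(\<Sum>v\<in>?Y. d u v) = a i - 1" if u: "u \<in> ?Y" for u
    proof -
      have "(\<Sum>v\<in>?Y. d u v) = (\<Sum>v\<in>?Y - {u}. d u v)"
        using sum.remove[of ?Y u "d u"] u fin by (simp add: d_def)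
      also have "\<dots> = (\<Sum>v\<in>?Y - {u}. 1)" using u by (intro sum.cong) (auto simp: d_def)
      moreover have "card ?Y = Suc (card (?Y - {u}))" using u fin by (intro card.remove) auto
      ultimately show ?thesis using card[OF \<open>i \<le> m\<close>] by simp
    qed
    then have "(\<Sum>u\<in>?Y. \<Sum>v\<in>?Y. d u v) = a i * (a i - 1)"
      using card[OF that] by simp
    ultimately show ?thesis unfolding A_def XS(1)
      using double_sum_Un[OF finX _ XS(2) sym, of i] fin by simp
  qed
  \<comment> \<open>Level sizes alternate, so the recurrences are solved two levels at a time.
    \<open>t\<close> occurs in \<open>B (2 * q)\<close> but cancels in
    \<open>A (2 * q)\<close>.\<close>
  have even: "real (card (X (2 * q))) = real k * q \<and>
      B (2 * q) = real k * q * (q + 1) - q * (real k - t) \<and>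
      A (2 * q) = max_dist_sum k q 0" if "2 * q \<le> Suc m" for q
    using that
  proof (induction q)
    case 0
    have "X 0 = {}" by (simp add: X_def)
    then show ?case by (simp add: A_def B_def max_dist_sum_def)
  next
    case (Suc q)
    then have q: "2 * q \<le> m" "Suc (2 * q) \<le> m" and IH: "real (card (X (2 * q))) = real k * q"
      "B (2 * q) = real k * q * (q + 1) - q * (real k - t)" "A (2 * q) = max_dist_sum k q 0"
      by auto
    have N1: "real (card (X (Suc (2 * q)))) = real k * q + t"
      using N[OF q(1)] IH by (simp add: a_def)
    have N2: "real (card (X (Suc (Suc (2 * q))))) = real k * q + k"
      using N[OF q(2)] N1 by (simp add: a_def)
    have B1: "B (Suc (2 * q)) = real k * q * (q + 1) - q * (real k - t) + real k * q + t"
      using B_Suc[OF q(1)] IH N1 by simp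
    have B2: "B (Suc (Suc (2 * q))) = real k * q * (q + 1) - q * (real k - t) + 2 * real k * q + k + t"
      using B_Suc[OF q(2)] B1 N2 by simp
    have A1: "A (Suc (2 * q)) = max_dist_sum k q 0 +
        2 * t * (real k * q * (q + 1) - q * (real k - t)) + t * (real t - 1)"
      using A_Suc[OF q(1)] IH by (simp add: a_def)
    have A2: "A (Suc (Suc (2 * q))) = max_dist_sum k (Suc q) 0"
      unfolding A_Suc[OF q(2)] A1 B1
      by (simp add: a_def max_dist_sum_def power2_eq_square power3_eq_cube field_simps)
    have "2 * Suc q = Suc (Suc (2 * q))" by simp
    then show ?case using N2 B2 A2 by (simp add: algebra_simps)
  qed
  have "A (Suc m) = max_dist_sum k s (p * t)"
  proof (cases "p = 0")
    case True
    then show ?thesis using even[of s] m by simp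
  next
    case False
    then have ms: "m = 2 * s" "p = 1" using m by auto
    then show ?thesis using A_Suc[of "2 * s"] even[of s]
      by (simp add: a_def max_dist_sum_def power2_eq_square field_simps)
  qed
  moreover have "X (Suc m) = V" using L by (auto simp: X_def level_path_def less_Suc_eq_le)
  moreover have "d u v \<le> real (gdist E u v)" if "u \<in> V" "v \<in> V" for u v
  proof (cases "u = v")
    case False
    have uv: "(u, v) \<in> (adj E)\<^sup>*" using uconn_rtrancl[OF H that] .
    have "gdist E u v \<noteq> 0" using gdist_eq_0[OF uv] False by blast
    then show ?thesis using level_path_gdist_ge[OF L uv] False by (simp add: d_def)
  qed (simp add: d_def)
  then have "(\<Sum>u\<in>V. \<Sum>v\<in>V. d u v) \<le> real (dist_sum V E)"
    unfolding dist_sum_def of_nat_sum by (intro sum_mono) auto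
  ultimately show ?thesis by (simp add: A_def)
qed

theorem level_path_dist_sum:
  assumes L: "level_path k t m V E l" and fin: "finite V" and t: "0 < t" "t < k" and k: "2 \<le> k"
    and m: "Suc m = 2 * s + p" "p \<le> 1" and s: "1 \<le> s" and n: "card V = k * s + p * t"
  shows "uconn k V E" "real (dist_sum V E) = max_dist_sum k s (p * t)"
proof -
  show H: "uconn k V E" using level_path_uconn[OF L fin t] m s by simp
  have "p * t < k" using m(2) t by (cases p) auto
  then show "real (dist_sum V E) = max_dist_sum k s (p * t)"
    using level_path_dist_sum_ge[OF L fin t H m] dist_sum_le[OF H k n _ s] by simp
qed

section \<open>Isomorphisms\<close>

text \<open>Corresponding levels have equal size; gluing bijections between them carries unions of
  consecutive levels, hence edges, to each other.\<close>

lemma level_path_iso: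
  assumes L: "level_path k t m (verts G) (edges G) l" "level_path k t m (verts H) (edges H) l'"
    and fin: "finite (verts G)" "finite (verts H)"
  shows "hypergraph_iso G H"
proof -
  let ?X = "\<lambda>i. {v \<in> verts G. l v = i}" and ?Y = "\<lambda>i. {v \<in> verts H. l' v = i}"
  have le: "\<And>v. v \<in> verts G \<Longrightarrow> l v \<le> m" "\<And>v. v \<in> verts H \<Longrightarrow> l' v \<le> m"
    using L by (auto simp: level_path_def)
  have "\<exists>g. bij_betw g (?X i) (?Y i)" if "i \<le> m" for i
    using that L fin by (intro finite_same_card_bij) (auto simp: level_path_def)
  then obtain g where g: "\<And>i. i \<le> m \<Longrightarrow> bij_betw (g i) (?X i) (?Y i)" by metis
  define f where "f = (\<lambda>v. g (l v) v)"
  have img: "f ` ?X i = ?Y i" if "i \<le> m" for i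
  proof -
    have "f ` ?X i = g i ` ?X i" by (intro image_cong) (auto simp: f_def)
    then show ?thesis using bij_betw_imp_surj_on[OF g[OF that]] by simp
  qed
  have fv: "f v \<in> verts H" "l' (f v) = l v" if "v \<in> verts G" for v
    using img[OF le(1)[OF that]] that by blast+
  have inj: "inj_on f (verts G)"
  proof (rule inj_onI)
    fix x y assume xy: "x \<in> verts G" "y \<in> verts G" "f x = f y"
    then have "l x = l y" using fv by metis
    then show "x = y" using xy bij_betw_imp_inj_on[OF g[OF le(1)[OF xy(1)]]]
      by (auto simp: f_def dest: inj_onD)
  qed
  have surj: "f ` verts G = verts H"
  proof
    show "verts H \<subseteq> f ` verts G"
    proof
      fix w assume w: "w \<in> verts H"
      then have "w \<in> f ` ?X (l' w)" using img[OF le(2)[OF w]] by simp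
      then show "w \<in> f ` verts G" by blast
    qed
  qed (use fv in blast)
  have two: "f ` {v \<in> verts G. l v = i \<or> l v = Suc i} = {v \<in> verts H. l' v = i \<or> l' v = Suc i}"
    if "i < m" for i
  proof -
    have "f ` (?X i \<union> ?X (Suc i)) = ?Y i \<union> ?Y (Suc i)"
      using img[of i] img[of "Suc i"] that by (simp only: image_Un)
    moreover have "?X i \<union> ?X (Suc i) = {v \<in> verts G. l v = i \<or> l v = Suc i}"
      "?Y i \<union> ?Y (Suc i) = {v \<in> verts H. l' v = i \<or> l' v = Suc i}" by auto
    ultimately show ?thesis by simp
  qed
  have "edges G = (\<lambda>i. {v \<in> verts G. l v = i \<or> l v = Suc i}) ` {..<m}"
    "edges H = (\<lambda>i. {v \<in> verts H. l' v = i \<or> l' v = Suc i}) ` {..<m}"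
    using L by (auto simp: level_path_def)
  then have "(\<lambda>e. f ` e) ` edges G = edges H"
    by (simp only: image_image) (intro image_cong refl, use two in auto)
  then show ?thesis unfolding hypergraph_iso_def bij_betw_def using inj surj by blast
qed

text \<open>The levels are pulled back along the isomorphism. It is injective on
  \<open>verts G\<close>, so edges can be recovered from their images.\<close>

lemma level_path_transfer:
  assumes iso: "hypergraph_iso G H" and L: "level_path k t m (verts H) (edges H) l"
    and E: "\<And>e. e \<in> edges G \<Longrightarrow> e \<subseteq> verts G"
  shows "\<exists>l'. level_path k t m (verts G) (edges G) l'"
proof -
  obtain f where f: "bij_betw f (verts G) (verts H)" "(\<lambda>e. f ` e) ` edges G = edges H"
    using iso by (auto simp: hypergraph_iso_def)
  have inj: "inj_on f (verts G)" and surj: "f ` verts G = verts H"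
    using f(1) by (auto simp: bij_betw_def)
  have img: "f ` {v \<in> verts G. P (f v)} = {w \<in> verts H. P w}" for P
    unfolding surj[symmetric] by auto
  let ?S = "\<lambda>i. {v \<in> verts G. l (f v) = i \<or> l (f v) = Suc i}"
    and ?T = "\<lambda>i. {w \<in> verts H. l w = i \<or> l w = Suc i}"
  have ST: "f ` ?S i = ?T i" for i by (rule img)
  have H: "edges H = ?T ` {..<m}" using L by (simp add: level_path_def)
  have "edges G = ?S ` {..<m}"
  proof
    show "edges G \<subseteq> ?S ` {..<m}"
    proof
      fix e assume e: "e \<in> edges G"
      then have "f ` e \<in> edges H" unfolding f(2)[symmetric] by (rule imageI)
      then obtain i where i: "i < m" "f ` e = ?T i" unfolding H by auto
      then have "f ` e = f ` ?S i" using ST by simp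
      then have "e = ?S i" using inj_on_image_eq_iff[OF inj E[OF e], of "?S i"] by blast
      then show "e \<in> ?S ` {..<m}" using i by blast
    qed
    show "?S ` {..<m} \<subseteq> edges G"
    proof
      fix S assume "S \<in> ?S ` {..<m}"
      then obtain i where i: "i < m" "S = ?S i" by blast
      then have "?T i \<in> edges H" unfolding H by auto
      then obtain e where e: "e \<in> edges G" "f ` e = ?T i" unfolding f(2)[symmetric] by auto
      then have "f ` e = f ` ?S i" using ST by simp
      then have "e = ?S i" using inj_on_image_eq_iff[OF inj E[OF e(1)], of "?S i"] by blast
      then show "S \<in> edges G" using i e by simp
    qed
  qed
  moreover have "card {v \<in> verts G. l (f v) = i} = card {w \<in> verts H. l w = i}" for i
  proof -
    have "inj_on f {v \<in> verts G. l (f v) = i}" by (rule inj_on_subset[OF inj]) auto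
    from card_image[OF this] show ?thesis by (simp only: img[of "\<lambda>w. l w = i"])
  qed
  moreover have "l (f v) \<le> m" if "v \<in> verts G" for v
    using that surj L by (auto simp: level_path_def)
  ultimately have "level_path k t m (verts G) (edges G) (\<lambda>v. l (f v))"
    using L unfolding level_path_def by simp
  then show ?thesis by blast
qed

section \<open>The extremal paths\<close>

text \<open>Each block of \<open>k\<close> consecutive vertices is cut after its first
  \<open>t\<close> into levels \<open>2 * j\<close> and \<open>2 * j + 1\<close>. Vertices are
  numbered from 1, hence \<open>v - 1\<close>.\<close>

definition path_level :: "nat \<Rightarrow> nat \<Rightarrow> nat \<Rightarrow> nat" where
  "path_level k t v = 2 * ((v - 1) div k) + (if (v - 1) mod k < t then 0 else 1)"

lemma path_level_iff:
  assumes t: "0 < t" "t < k" and v: "1 \<le> v"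
  shows "path_level k t v = 2 * j \<longleftrightarrow> j * k + 1 \<le> v \<and> v \<le> j * k + t"
    and "path_level k t v = 2 * j + 1 \<longleftrightarrow> j * k + t + 1 \<le> v \<and> v \<le> j * k + k"
proof -
  define q where "q = (v - 1) div k"
  define \<rho> where "\<rho> = (v - 1) mod k"
  have vq: "v = q * k + \<rho> + 1" using v by (simp add: q_def \<rho>_def)
  have \<rho>: "\<rho> < k" using t by (simp add: \<rho>_def)
  have lev: "path_level k t v = 2 * q + (if \<rho> < t then 0 else 1)"
    by (simp add: path_level_def q_def \<rho>_def)
  have "(2 * q + (if \<rho> < t then 0 else 1) = 2 * j \<longleftrightarrow> j * k + 1 \<le> v \<and> v \<le> j * k + t) \<and>
    (2 * q + (if \<rho> < t then 0 else 1) = 2 * j + 1 \<longleftrightarrow> j * k + t + 1 \<le> v \<and> v \<le> j * k + k)"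
  proof (cases q j rule: linorder_cases)
    case less
    then have "q * k + k \<le> j * k" using mult_le_mono1[of "Suc q" j k] by simp
    then have "\<not> j * k + 1 \<le> v" using vq \<rho> by linarith
    then show ?thesis using less by (cases "\<rho> < t"; simp; presburger)
  next
    case equal
    then show ?thesis using \<rho> t unfolding vq by (cases "\<rho> < t") auto
  next
    case greater
    then have "j * k + k \<le> q * k" using mult_le_mono1[of "Suc j" q k] by simp
    then have "\<not> v \<le> j * k + k" using vq by linarith
    then show ?thesis using greater t by (cases "\<rho> < t"; simp; presburger)
  qed
  then show "path_level k t v = 2 * j \<longleftrightarrow> j * k + 1 \<le> v \<and> v \<le> j * k + t"
    "path_level k t v = 2 * j + 1 \<longleftrightarrow> j * k + t + 1 \<le> v \<and> v \<le> j * k + k"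
    unfolding lev by simp_all
qed

text \<open>The blocks join levels \<open>2 * j\<close> and \<open>2 * j + 1\<close>, the shifted
  blocks levels \<open>2 * j + 1\<close> and \<open>2 * j + 2\<close>. Even \<open>m\<close> serves
  \<open>path_nondiv\<close>, odd \<open>m\<close> serves \<open>path_div\<close>.\<close>

lemma path_is_level_path:
  assumes t: "0 < t" "t < k" and n: "n = Suc m div 2 * k + (if even m then t else 0)"
  shows "level_path k t m {1..n}
    ({{(i - 1) * k + 1..i * k} | i. 1 \<le> i \<and> i \<le> Suc m div 2} \<union>
     {{t + (i - 1) * k + 1..i * k + t} | i. 1 \<le> i \<and> i \<le> m div 2}) (path_level k t)"
    (is "level_path k t m ?V (?A \<union> ?B) ?l")
proof -
  note iff = path_level_iff[OF t]
  \<comment> \<open>Levels up to \<open>m\<close> are complete intervals, not cut off at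
    \<open>n\<close>.\<close>
  have room: "j * k + t \<le> n" if "2 * j \<le> m" for j
  proof (cases "even m")
    case True
    then have "j \<le> Suc m div 2" using that by auto
    then show ?thesis using n True by simp
  next
    case False
    then have "Suc j \<le> Suc m div 2" using that by (auto elim!: oddE)
    then have "Suc j * k \<le> Suc m div 2 * k" by (rule mult_le_mono1)
    moreover have "n = Suc m div 2 * k" using n False by simp
    moreover have "Suc j * k = j * k + k" by simp
    ultimately show ?thesis using t by linarith
  qed
  have room': "j * k + k \<le> n" if "2 * j + 1 \<le> m" for j
  proof -
    have "Suc j \<le> Suc m div 2" using that by simp
    then have "Suc j * k \<le> Suc m div 2 * k" by (rule mult_le_mono1)
    moreover have "Suc m div 2 * k \<le> n" unfolding n by (rule le_add1)
    moreover have "Suc j * k = j * k + k" by simp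
    ultimately show ?thesis by linarith
  qed
  have lev_even: "{v \<in> ?V. ?l v = 2 * j} = {j * k + 1..j * k + t}" if "2 * j \<le> m" for j
    using room[OF that] by (auto simp: iff)
  have lev_odd: "{v \<in> ?V. ?l v = 2 * j + 1} = {j * k + t + 1..j * k + k}" if "2 * j + 1 \<le> m" for j
    using room'[OF that] iff(2)[of _ j] by auto
  have card: "card {v \<in> ?V. ?l v = i} = (if even i then t else k - t)" if "i \<le> m" for i
  proof (cases "even i")
    case True
    then obtain j where "i = 2 * j" by (rule evenE)
    then show ?thesis using lev_even[of j] that by simp
  next
    case False
    then obtain j where "i = 2 * j + 1" by (rule oddE)
    then show ?thesis using lev_odd[of j] that by simp
  qed
  have le: "?l v \<le> m" if v: "v \<in> ?V" for v
  proof (rule ccontr)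
    assume "\<not> ?l v \<le> m"
    then have big: "Suc m \<le> ?l v" by simp
    have vn: "v \<le> n" using v by simp
    show False
    proof (cases "even (?l v)")
      case True
      then obtain j where j: "?l v = 2 * j" by (rule evenE)
      then have "j * k + 1 \<le> v" using iff(1)[of v j] v by auto
      \<comment> \<open>The left side is the least \<open>j\<close> with \<open>m < 2 * j\<close>,
        and the interval of that level starts beyond \<open>n\<close>.\<close>
      moreover have "Suc m div 2 + (if even m then 1 else 0) \<le> j"
        using big j by (cases "even m") (auto elim!: evenE oddE)
      then have "(Suc m div 2 + (if even m then 1 else 0)) * k \<le> j * k" by (rule mult_le_mono1)
      moreover have "n \<le> (Suc m div 2 + (if even m then 1 else 0)) * k"
        unfolding n using t by (simp add: add_mult_distrib)
      ultimately show False using vn by linarith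
    next
      case False
      then obtain j where j: "?l v = 2 * j + 1" by (rule oddE)
      then have "j * k + t + 1 \<le> v" using iff(2)[of v j] v by auto
      moreover have "Suc m div 2 \<le> j" using big j by simp
      then have "Suc m div 2 * k \<le> j * k" by (rule mult_le_mono1)
      moreover have "n \<le> Suc m div 2 * k + t" unfolding n by simp
      ultimately show False using vn by linarith
    qed
  qed
  define T where "T = (\<lambda>i. {v \<in> ?V. ?l v = i \<or> ?l v = Suc i})"
  have T_even: "T (2 * j) = {j * k + 1..j * k + k}" if "2 * j < m" for j
  proof -
    have "T (2 * j) = {v \<in> ?V. ?l v = 2 * j} \<union> {v \<in> ?V. ?l v = 2 * j + 1}"
      by (auto simp: T_def)
    also have "\<dots> = {j * k + 1..j * k + t} \<union> {j * k + t + 1..j * k + k}"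
      using lev_even[of j] lev_odd[of j] that by simp
    finally show ?thesis using t by auto
  qed
  have T_odd: "T (2 * j + 1) = {t + j * k + 1..Suc j * k + t}" if "2 * j + 1 < m" for j
  proof -
    have "T (2 * j + 1) = {v \<in> ?V. ?l v = 2 * j + 1} \<union> {v \<in> ?V. ?l v = 2 * Suc j}"
      by (auto simp: T_def)
    also have "\<dots> = {j * k + t + 1..j * k + k} \<union> {Suc j * k + 1..Suc j * k + t}"
      using lev_even[of "Suc j"] lev_odd[of j] that by simp
    also have "\<dots> = {t + j * k + 1..Suc j * k + t}"
    proof -
      have "{a + t + 1..a + k} \<union> {a + k + 1..a + k + t} = {t + a + 1..a + k + t}" for a
        using t by auto
      from this[of "j * k"] show ?thesis by (simp only: mult_Suc add.commute[of k])
    qed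
    finally show ?thesis .
  qed
  have "?A \<union> ?B = T ` {..<m}"
  proof
    show "?A \<union> ?B \<subseteq> T ` {..<m}"
    proof
      fix e assume "e \<in> ?A \<union> ?B"
      then consider i where "1 \<le> i" "i \<le> Suc m div 2" "e = {(i - 1) * k + 1..i * k}"
        | i where "1 \<le> i" "i \<le> m div 2" "e = {t + (i - 1) * k + 1..i * k + t}" by blast
      then show "e \<in> T ` {..<m}"
      proof cases
        case 1
        then obtain j where j: "i = Suc j" by (cases i) auto
        then have "2 * j < m" using 1 by simp
        then show ?thesis using T_even[of j] 1 j by (auto simp: add.commute intro!: image_eqI[of _ _ "2 * j"])
      next
        case 2
        then obtain j where j: "i = Suc j" by (cases i) auto
        then have "2 * j + 1 < m" using 2 by simp
        then show ?thesis using T_odd[of j] 2 j by (intro image_eqI[of _ _ "2 * j + 1"]) simp_all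
      qed
    qed
    show "T ` {..<m} \<subseteq> ?A \<union> ?B"
    proof
      fix e assume "e \<in> T ` {..<m}"
      then obtain i where i: "i < m" and e: "e = T i" by auto
      show "e \<in> ?A \<union> ?B"
      proof (cases "even i")
        case True
        then obtain j where j: "i = 2 * j" by (rule evenE)
        then have "T i = {(Suc j - 1) * k + 1..Suc j * k}" "1 \<le> Suc j" "Suc j \<le> Suc m div 2"
          using T_even[of j] i by (auto simp: add.commute)
        then show ?thesis unfolding e by blast
      next
        case False
        then obtain j where j: "i = 2 * j + 1" by (rule oddE)
        then have "T i = {t + (Suc j - 1) * k + 1..Suc j * k + t}" "1 \<le> Suc j" "Suc j \<le> m div 2"
          using T_odd[of j] i by auto
        then show ?thesis unfolding e by blast
      qed
    qed
  qed
  then show ?thesis unfolding level_path_def T_def using le card by blast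
qed

section \<open>The named paths as level paths, and their Wiener index\<close>

lemma path_nondiv_level_path:
  assumes "n = k * s + r" "0 < r" "r < k"
  shows "level_path k r (2 * s) (verts (path_nondiv k n)) (edges (path_nondiv k n)) (path_level k r)"
proof -
  have "n div k = s" "n mod k = r" using assms by simp_all
  then show ?thesis using path_is_level_path[of r k n "2 * s"] assms
    by (simp add: path_nondiv_def Let_def mult.commute)
qed

lemma path_div_level_path:
  assumes "n = k * s" "0 < x" "x < k" "1 \<le> s"
  shows "level_path k x (2 * s - 1) (verts (path_div k n x)) (edges (path_div k n x)) (path_level k x)"
proof -
  have s: "n div k = s" "Suc (2 * s - 1) div 2 = s" "(2 * s - 1) div 2 = s - 1" "odd (2 * s - 1)"
    using assms by auto
  have "level_path k x (2 * s - 1) {1..n}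
    ({{(i - 1) * k + 1..i * k} | i. 1 \<le> i \<and> i \<le> s} \<union>
     {{x + (i - 1) * k + 1..i * k + x} | i. 1 \<le> i \<and> i \<le> s - 1}) (path_level k x)"
    using path_is_level_path[of x k n "2 * s - 1"] assms s by (simp add: mult.commute)
  then show ?thesis by (simp add: path_div_def Let_def s add.commute[of x])
qed

text \<open>For \<open>p = 0\<close> the value does not involve \<open>t\<close>, so all
  \<open>path_div k n x\<close> with \<open>0 < x < k\<close> have the same Wiener index.\<close>

lemma wiener_index_level_path:
  assumes L: "level_path k t m (verts H) (edges H) l" and fin: "finite (verts H)"
    and t: "0 < t" "t < k" and k: "2 \<le> k"
    and m: "Suc m = 2 * s + p" "p \<le> 1" and s: "1 \<le> s" and n: "card (verts H) = k * s + p * t"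
  shows "2 * real (wiener_index H) = max_dist_sum k s (p * t)"
proof -
  note D = level_path_dist_sum[OF L fin t k m s n]
  show ?thesis using wiener_index_eq_dist_sum[OF D(1)] D(2)
    by (metis of_nat_mult of_nat_numeral)
qed

text \<open>Uniqueness of division with remainder by \<open>k\<close>. A non-zero remainder
  determines \<open>t\<close>; for remainder 0 only \<open>m\<close> is determined, and
  \<open>t\<close> becomes the parameter \<open>x\<close>.\<close>

lemma level_count_cases:
  assumes n: "k * s + r = Suc m div 2 * k + (if even m then t else 0)"
    and r: "r < k" and t: "0 < t" "t < k"
  shows "r \<noteq> 0 \<Longrightarrow> t = r \<and> m = 2 * s" "r = 0 \<Longrightarrow> Suc m = 2 * s"
proof -
  define t' where "t' = (if even m then t else 0)"
  have "t' < k" using t by (simp add: t'_def)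
  have "(k * s + r) div k = s" "(k * s + r) mod k = r" using r by simp_all
  moreover have "(Suc m div 2 * k + t') div k = Suc m div 2" "(Suc m div 2 * k + t') mod k = t'"
    using \<open>t' < k\<close> by simp_all
  ultimately have "s = Suc m div 2" "r = t'" using n unfolding t'_def by simp_all
  then show "r \<noteq> 0 \<Longrightarrow> t = r \<and> m = 2 * s" "r = 0 \<Longrightarrow> Suc m = 2 * s"
    using t by (auto simp: t'_def split: if_splits)
qed

theorem theorem2:
  fixes k n s r :: nat and H :: "'a hypergraph"
  assumes "2 \<le> k" and "k \<le> n"
    and "n = k * s + r" and "1 \<le> s" and "r < k"
    and "uniform_hypergraph k H" and "card (verts H) = n"
    and "connected_hypergraph H"
  shows "(r \<noteq> 0 \<longrightarrow>
            wiener_index H \<le> wiener_index (path_nondiv k n) \<and>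
            (wiener_index H = wiener_index (path_nondiv k n) \<longleftrightarrow>
               hypergraph_iso H (path_nondiv k n))) \<and>
         (r = 0 \<longrightarrow>
            wiener_index H \<le> wiener_index (path_div k n 1) \<and>
            (wiener_index H = wiener_index (path_div k n 1) \<longleftrightarrow>
               (\<exists>x. 0 < x \<and> x < k \<and> hypergraph_iso H (path_div k n x))))"
proof -
  note k = assms(1) and n = assms(3) and s = assms(4) and r = assms(5) and cardH = assms(7)
  have H: "uconn k (verts H) (edges H)" using connected_iff_uconn assms(6,8) by blast
  have fin: "finite (verts H)" by (rule uconn_finite[OF H])
  have edge: "\<And>e. e \<in> edges H \<Longrightarrow> e \<subseteq> verts H" using uconn_edge[OF H] by blast
  have W: "2 * real (wiener_index H) = real (dist_sum (verts H) (edges H))"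
    using wiener_index_eq_dist_sum[OF H] by (metis of_nat_mult of_nat_numeral)
  have le: "2 * real (wiener_index H) \<le> max_dist_sum k s r"
    and eqD: "2 * real (wiener_index H) = max_dist_sum k s r \<Longrightarrow>
      \<exists>t m l. 0 < t \<and> t < k \<and> k * s + r = Suc m div 2 * k + (if even m then t else 0) \<and>
        level_path k t m (verts H) (edges H) l"
    using dist_sum_le[OF H k _ r s] cardH n unfolding W by auto
  show ?thesis
  proof (intro conjI impI)
    assume r0: "r \<noteq> 0"
    let ?P = "path_nondiv k n"
    have P: "level_path k r (2 * s) (verts ?P) (edges ?P) (path_level k r)"
      using r0 by (intro path_nondiv_level_path[OF n _ r]) simp
    have V: "verts ?P = {1..n}" by (simp add: path_nondiv_def Let_def)
    have WP: "2 * real (wiener_index ?P) = max_dist_sum k s r"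
      using wiener_index_level_path[OF P _ _ r k, of s 1] r0 s V n by simp
    show "wiener_index H \<le> wiener_index ?P" using le WP by linarith
    show "wiener_index H = wiener_index ?P \<longleftrightarrow> hypergraph_iso H ?P"
    proof
      assume "wiener_index H = wiener_index ?P"
      then obtain t m l where L: "0 < t" "t < k"
          "k * s + r = Suc m div 2 * k + (if even m then t else 0)"
          "level_path k t m (verts H) (edges H) l"
        using eqD WP by auto
      then have "t = r" "m = 2 * s" using level_count_cases(1)[OF L(3) r L(1,2) r0] by auto
      then show "hypergraph_iso H ?P" using level_path_iso[OF _ P fin] L(4) V by simp
    next
      assume "hypergraph_iso H ?P"
      then obtain l where L: "level_path k r (2 * s) (verts H) (edges H) l"
        using level_path_transfer[OF _ P edge] by blast
      show "wiener_index H = wiener_index ?P"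
        using wiener_index_level_path[OF L fin _ r k, of s 1] WP r0 s cardH n by simp
    qed
  next
    assume r0: "r = 0"
    then have n': "n = k * s" using n by simp
    \<comment> \<open>Written with \<open>+ 0\<close> to match the premise of
      \<open>wiener_index_level_path\<close> for \<open>p = 0\<close>.\<close>
    have m: "Suc (2 * s - 1) = 2 * s + 0" using s by simp
    have P: "level_path k x (2 * s - 1) (verts (path_div k n x)) (edges (path_div k n x)) (path_level k x)"
      if "0 < x" "x < k" for x by (rule path_div_level_path[OF n' that s])
    have V: "verts (path_div k n x) = {1..n}" for x by (simp add: path_div_def Let_def)
    have WP: "2 * real (wiener_index (path_div k n 1)) = max_dist_sum k s r"
      using wiener_index_level_path[OF P _ _ _ k m] k s V n' r0 by simp
    show "wiener_index H \<le> wiener_index (path_div k n 1)" using le WP by linarith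
    show "wiener_index H = wiener_index (path_div k n 1) \<longleftrightarrow>
        (\<exists>x. 0 < x \<and> x < k \<and> hypergraph_iso H (path_div k n x))"
    proof
      assume "wiener_index H = wiener_index (path_div k n 1)"
      then obtain t m l where L: "0 < t" "t < k"
          "k * s + r = Suc m div 2 * k + (if even m then t else 0)"
          "level_path k t m (verts H) (edges H) l"
        using eqD WP by auto
      then have "m = 2 * s - 1" using level_count_cases(2)[OF L(3) r L(1,2) r0] by simp
      then have "hypergraph_iso H (path_div k n t)"
        using level_path_iso[OF _ P[OF L(1,2)] fin] L(4) V by simp
      then show "\<exists>x. 0 < x \<and> x < k \<and> hypergraph_iso H (path_div k n x)" using L by blast
    next
      assume "\<exists>x. 0 < x \<and> x < k \<and> hypergraph_iso H (path_div k n x)"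
      then obtain x where x: "0 < x" "x < k" "hypergraph_iso H (path_div k n x)" by blast
      obtain l where L: "level_path k x (2 * s - 1) (verts H) (edges H) l"
        using level_path_transfer[OF x(3) P[OF x(1,2)] edge] by blast
      show "wiener_index H = wiener_index (path_div k n 1)"
        using wiener_index_level_path[OF L fin x(1,2) k m _ s] WP cardH n' r0 by simp
    qed
  qed
qed

end
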